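(* For $n\ge 1$ let $p_n:=\sup\{p\ge 2:\ \|P_n^+\|_{\infty,p}\le 1\}$, and let $p_\infty:=\sup\{p\ge 2:\ \|P_\infty^+\|_{\infty,p}\le 1\}$, where $\|P_n^+\|_{\infty,p}$ (respectively $\|P_\infty^+\|_{\infty,p}$) is the norm of the Riesz projection as an operator from $L^\infty(\mathbb{T}^n)$ to $L^p(\mathbb{T}^n)$ (respectively from $L^\infty(\mathbb{T}^\infty)$ to $L^p(\mathbb{T}^\infty)$). Then $$p_\infty=\lim_{n\to\infty}p_n=2.$$
   Context: $\mathbb{T}$ is the unit circle; $\mathbb{T}^n$ carries the $n$-fold product $m_n$ of normalized Lebesgue measure on $\mathbb{T}$, and $\mathbb{T}^\infty$ (countable product) carries Haar measure $m_\infty$, the countable product of normalized Lebesgue measures; $L^p$ norms are taken with respect to these measures. Functions $f\in L^1(\mathbb{T}^n)$ have Fourier series $\sum_{\alpha\in\mathbb{Z}^n}\hat f(\alpha)\zeta^\alpha$; functions in $L^1(\mathbb{T}^\infty)$ have Fourier series indexed by the integer multi-indices $\alpha=(\alpha_1,\alpha_2,\dots)$ with only finitely many non-zero entries. The Riesz projection $P_n^+$ is $P_n^+f:=\sum_{\alpha\in\mathbb{Z}_+^n}\hat f(\alpha)\zeta^\alpha$, where $\mathbb{Z}_+=\{0,1,2,\dots\}$; $P_\infty^+$ is defined in the same way, keeping exactly the coefficients whose multi-index has all entries $\ge 0$. Both are orthogonal projections on $L^2$, hence well defined on $L^\infty\subset L^2$; the norm $\|\cdot\|_{\infty,p}$ is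 $+\infty$ if the operator does not map $L^\infty$ boundedly into $L^p$. *)

theory Defs
  imports "HOL-Probability.Probability"
begin

definition circle_measure :: "complex measure" where
  "circle_measure =
     distr (uniform_measure lborel {0..1}) (restrict_space borel (sphere 0 1))
       (\<lambda>t. cis (2 * pi * t))"

text \<open>
  The torus with coordinates indexed by \<open>I\<close>. The set \<open>{..<n}\<close> gives the \<open>n\<close>-dimensional torus
  with the measure \<open>m\<^sub>n\<close>, and \<open>UNIV\<close> gives the infinite-dimensional torus with its Haar measure.
\<close>

definition torus :: "nat set \<Rightarrow> (nat \<Rightarrow> complex) measure" where
  "torus I = Pi\<^sub>M I (\<lambda>_. circle_measure)"

definition Lp_norm :: "'a measure \<Rightarrow> real \<Rightarrow> ('a \<Rightarrow> complex) \<Rightarrow> ennreal" where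
  "Lp_norm M p f =
     (let J = (\<integral>\<^sup>+ x. ennreal (cmod (f x) powr p) \<partial>M)
      in if J = \<infinity> then \<infinity> else ennreal (enn2real J powr (1 / p)))"

definition Linf_norm :: "'a measure \<Rightarrow> ('a \<Rightarrow> complex) \<Rightarrow> ennreal" where
  "Linf_norm M f = esssup M (\<lambda>x. ennreal (cmod (f x)))"

text \<open>
  A multi-index for the torus over \<open>I\<close> is extended by \<open>0\<close> outside \<open>I\<close>.
\<close>

definition multi_indices :: "nat set \<Rightarrow> (nat \<Rightarrow> int) set" where
  "multi_indices I = {\<alpha>. {i. \<alpha> i \<noteq> 0} \<subseteq> I \<and> finite {i. \<alpha> i \<noteq> 0}}"

definition nonneg_multi_indices :: "nat set \<Rightarrow> (nat \<Rightarrow> int) set" where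
  "nonneg_multi_indices I = {\<alpha> \<in> multi_indices I. \<forall>i. 0 \<le> \<alpha> i}"

definition character :: "(nat \<Rightarrow> int) \<Rightarrow> (nat \<Rightarrow> complex) \<Rightarrow> complex" where
  "character \<alpha> \<zeta> = (\<Prod>i | \<alpha> i \<noteq> 0. \<zeta> i powi \<alpha> i)"

definition fourier_coeff ::
    "nat set \<Rightarrow> ((nat \<Rightarrow> complex) \<Rightarrow> complex) \<Rightarrow> (nat \<Rightarrow> int) \<Rightarrow> complex" where
  "fourier_coeff I f \<alpha> = (LINT \<zeta>|torus I. f \<zeta> * cnj (character \<alpha> \<zeta>))"

text \<open>
  The relation \<open>has_riesz_projection I f g\<close> says that \<open>g\<close> is the sum of the Fourier series of \<open>f\<close>
  restricted to the non-negative multi-indices, as an unordered sum converging in \<open>L\<^sup>2\<close>. For \<open>f\<close> in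
  \<open>L\<^sup>2\<close> such a \<open>g\<close> exists and is unique up to null sets; \<open>riesz_projection I f\<close> is one
  representative.
\<close>

definition has_riesz_projection ::
    "nat set \<Rightarrow> ((nat \<Rightarrow> complex) \<Rightarrow> complex) \<Rightarrow> ((nat \<Rightarrow> complex) \<Rightarrow> complex) \<Rightarrow> bool" where
  "has_riesz_projection I f g \<longleftrightarrow>
     g \<in> borel_measurable (torus I) \<and>
     ((\<lambda>F. Lp_norm (torus I) 2
         (\<lambda>\<zeta>. g \<zeta> - (\<Sum>\<alpha>\<in>F. fourier_coeff I f \<alpha> * character \<alpha> \<zeta>)))
       \<longlongrightarrow> 0) (finite_subsets_at_top (nonneg_multi_indices I))"

definition riesz_projection ::
    "nat set \<Rightarrow> ((nat \<Rightarrow> complex) \<Rightarrow> complex) \<Rightarrow> (nat \<Rightarrow> complex) \<Rightarrow> complex" where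
  "riesz_projection I f = (SOME g. has_riesz_projection I f g)"

text \<open>
  The operator norm from \<open>L\<^sup>\<infinity>\<close> to \<open>L\<^sup>p\<close>, with value \<open>\<infinity>\<close> if the Riesz projection is not bounded
  between these spaces. The measurability of \<open>f\<close> is a separate condition because \<^const>\<open>esssup\<close>
  only sees the modulus of \<open>f\<close>.
\<close>

definition riesz_norm :: "nat set \<Rightarrow> real \<Rightarrow> ennreal" where
  "riesz_norm I p =
     (SUP f \<in> {f \<in> borel_measurable (torus I). Linf_norm (torus I) f \<le> 1}.
        Lp_norm (torus I) p (riesz_projection I f))"

definition critical_exponent :: "nat set \<Rightarrow> ereal" where
  "critical_exponent I = Sup {ereal p | p. 2 \<le> p \<and> riesz_norm I p \<le> 1}"

definition p_fin :: "nat \<Rightarrow> ereal" where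
  "p_fin n = critical_exponent {..<n}"

definition p_inf :: ereal where
  "p_inf = critical_exponent UNIV"

end

theory Submission
  imports Defs
begin

text \<open>
  Bessel's inequality and the Riesz--Fischer theorem give \<open>\<parallel>P\<parallel>\<^sub>\<infinity>\<^sub>,\<^sub>2 \<le> 1\<close>, so every critical
  exponent is at least \<open>2\<close>. For \<open>p > 2\<close> a Kakeya-type configuration on a torus of large dimension
  violates \<open>\<parallel>P\<parallel>\<^sub>\<infinity>\<^sub>,\<^sub>p \<le> 1\<close>. Toss \<open>n\<close> independent coins \<open>z\<^sub>1, \<dots>, z\<^sub>n\<close>, where \<open>z\<^sub>j\<close> shows heads on a half
  circle. The events \<open>A\<^sub>j\<close> that \<open>z\<^sub>j\<close> is the only head are disjoint, but averaging
  \<open>1\<^bsub>A\<^sub>j\<^esub>\<close> over \<open>z\<^sub>j\<close> moves part of the mass to the event \<open>B\<close> that there is no head, which all \<open>A\<^sub>j\<close>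
  share. The Riesz projection \<open>P\<^sub>j\<close> in \<open>z\<^sub>j\<close> has the same effect, because
  \<open>Re (P\<^sub>j a) = (a + E a) / 2\<close> for real \<open>a\<close>. With further independent variables \<open>w\<^sub>j\<close> as signs, the
  function equal to \<open>w\<^sub>j\<close> on \<open>A\<^sub>j\<close> and to \<open>w\<^sub>0\<close> elsewhere is bounded by \<open>1\<close>, while projecting
  the \<open>j\<close>-th piece in \<open>z\<^sub>j\<close> gives mean square of order \<open>n\<close> on \<open>B\<close>. Since \<open>B\<close> has measure \<open>2\<^sup>-\<^sup>n\<close> and the
  \<open>A\<^sub>j\<close> together \<open>n 2\<^sup>-\<^sup>n\<close>, the gain \<open>n\<^sup>p\<^sup>/\<^sup>2 2\<^sup>-\<^sup>n\<close> in the \<open>p\<close>-th moment exceeds the loss \<open>n 2\<^sup>-\<^sup>n\<close>.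
  Indicators are replaced by trigonometric polynomials of degree at most \<open>D\<close>, and multiplying the
  \<open>j\<close>-th piece by \<open>\<Prod>i\<noteq>j. z\<^sub>i\<^sup>D\<close> ensures that the full projection acts on it only through \<open>z\<^sub>j\<close>.
\<close>

subsection \<open>Integration on the torus\<close>

lemma space_circle_measure [simp]: "space circle_measure = sphere 0 1"
  by (simp add: circle_measure_def space_restrict_space)

lemma sets_circle_measure [measurable_cong]:
  "sets circle_measure = sets (restrict_space borel (sphere 0 1))"
  by (simp add: circle_measure_def)

lemma measurable_cis_circle:
  "(\<lambda>t. cis (2 * pi * t)) \<in> borel \<rightarrow>\<^sub>M restrict_space borel (sphere 0 1)"
  by (rule measurable_restrict_space2)
     (auto intro!: borel_measurable_continuous_onI continuous_intros)

lemma prob_space_circle_measure: "prob_space circle_measure"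
  unfolding circle_measure_def
proof (rule prob_space.prob_space_distr)
  show "prob_space (uniform_measure lborel {0..1::real})"
    by (rule prob_space_uniform_measure) auto
  show "(\<lambda>t. cis (2 * pi * t)) \<in>
      uniform_measure lborel {0..1::real} \<rightarrow>\<^sub>M restrict_space borel (sphere 0 1)"
    using measurable_cis_circle by simp
qed

interpretation circle: prob_space circle_measure
  by (rule prob_space_circle_measure)

lemma measurable_circle_borel:
  fixes f :: "complex \<Rightarrow> 'b::topological_space"
  assumes "continuous_on (sphere 0 1) f"
  shows "f \<in> borel_measurable circle_measure"
  using assms unfolding measurable_cong_sets[OF sets_circle_measure refl]
  by (rule borel_measurable_continuous_on_restrict)

text \<open>The integral over \<open>lebesgue_on {0..1}\<close> is also a Henstock-Kurzweil
  integral, for which the fundamental theorem of calculus is at hand. As \<open>{0..1}\<close> has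
  length 1, the density of the uniform measure is the bare indicator.\<close>

lemma circle_integral:
  fixes f :: "complex \<Rightarrow> 'b::{banach, second_countable_topology}"
  assumes [measurable]: "f \<in> borel_measurable circle_measure"
  shows "(LINT z|circle_measure. f z) = integral\<^sup>L (lebesgue_on {0..1}) (\<lambda>t. f (cis (2 * pi * t)))"
proof -
  have f: "f \<in> borel_measurable (restrict_space borel (sphere 0 1))"
    using assms by (simp add: measurable_cong_sets[OF sets_circle_measure refl])
  have m: "(\<lambda>t. f (cis (2 * pi * t))) \<in> borel_measurable borel"
    using measurable_compose[OF measurable_cis_circle f] by simp
  have "(LINT z|circle_measure. f z) =
      (LINT t|uniform_measure lborel {0..1}. f (cis (2 * pi * t)))"
    unfolding circle_measure_def using measurable_cis_circle f
    by (subst integral_distr) simp_all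
  also have "uniform_measure lborel {0..1::real} = density lborel (\<lambda>t. ennreal (indicator {0..1} t))"
    by (auto simp: uniform_measure_def fun_eq_iff divide_ennreal_def indicator_def intro!: arg_cong2[where f=density])
  also have "(LINT t|density lborel (\<lambda>t. ennreal (indicator {0..1} t)). f (cis (2 * pi * t)))
      = (LINT t|lborel. indicator {0..1} t *\<^sub>R f (cis (2 * pi * t)))"
    using m by (subst integral_density) auto
  also have "\<dots> = (LINT t|lebesgue. indicator {0..1} t *\<^sub>R f (cis (2 * pi * t)))"
    using m by (subst integral_completion) auto
  also have "\<dots> = integral\<^sup>L (lebesgue_on {0..1}) (\<lambda>t. f (cis (2 * pi * t)))"
    by (subst integral_restrict_space) auto
  finally show ?thesis .
qed

lemma continuous_on_circle_powi: "continuous_on (sphere 0 1) (\<lambda>z::complex. z powi k)"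
  by (auto intro!: continuous_intros)

text \<open>The exponential has the same value at both ends of \<open>{0..1}\<close>, so its
  derivative integrates to 0; for \<open>k \<noteq> 0\<close> the derivative is the exponential
  times the nonzero constant \<open>?A\<close>.\<close>

lemma circle_integral_powi:
  assumes "k \<noteq> 0"
  shows "(LINT z|circle_measure. z powi k) = (0::complex)"
proof -
  let ?A = "of_real (2 * pi * of_int k) * \<i>"
  have cis_exp: "cis (2 * pi * of_int k * t) = exp (t *\<^sub>R ?A)" for t
    by (simp add: cis_conv_exp scaleR_conv_of_real mult_ac)
  have "((\<lambda>t. exp (t *\<^sub>R ?A) * ?A) has_integral (exp (1 *\<^sub>R ?A) - exp (0 *\<^sub>R ?A))) {0..1}"
    by (rule fundamental_theorem_of_calculus)
       (auto intro: exp_scaleR_has_vector_derivative_right)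
  moreover have "exp (1 *\<^sub>R ?A) = 1"
    unfolding cis_exp[symmetric] using cis_multiple_2pi[of "of_int k"] by simp
  ultimately have "((\<lambda>t. exp (t *\<^sub>R ?A) * ?A) has_integral 0) {0..1}"
    by simp
  then have "((\<lambda>t. exp (t *\<^sub>R ?A) * ?A * (1 / ?A)) has_integral 0 * (1 / ?A)) {0..1}"
    by (rule has_integral_mult_left)
  then have I: "((\<lambda>t. cis (2 * pi * of_int k * t)) has_integral 0) {0..1}"
    unfolding cis_exp using assms by simp
  have "continuous_on {0..1} (\<lambda>t. cis (2 * pi * of_int k * t))"
    by (intro continuous_intros)
  then have "integrable (lebesgue_on {0..1}) (\<lambda>t. cis (2 * pi * of_int k * t))"
    by (rule continuous_imp_integrable_real)
  then have "integral\<^sup>L (lebesgue_on {0..1}) (\<lambda>t. cis (2 * pi * of_int k * t)) = 0"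
    using integral_unique[OF I] by (subst lebesgue_integral_eq_integral) auto
  then show ?thesis
    by (subst circle_integral)
       (auto intro!: measurable_circle_borel continuous_on_circle_powi simp: cis_power_int mult_ac)
qed

lemma prob_space_torus: "prob_space (torus I)"
  unfolding torus_def by (intro prob_space_PiM prob_space_circle_measure)

interpretation torus: prob_space "torus I" for I
  by (rule prob_space_torus)

lemma space_torusD: "\<zeta> \<in> space (torus I) \<Longrightarrow> i \<in> I \<Longrightarrow> norm (\<zeta> i) = 1"
  by (auto simp: torus_def space_PiM PiE_iff)

lemma measurable_torus_coord:
  assumes "i \<in> I" "f \<in> borel_measurable circle_measure"
  shows "(\<lambda>\<zeta>. f (\<zeta> i)) \<in> borel_measurable (torus I)"
  unfolding torus_def using assms by (intro measurable_compose[OF measurable_component_singleton])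

text \<open>Replacing coordinate \<open>k\<close> by an independent point of the circle preserves
  the product measure. Since \<open>\<psi>\<close> does not see that coordinate, Fubini separates
  the two factors. Orthogonality of characters, product formulas and the averaging over signs all
  rest on this form of independence.\<close>

lemma torus_integral_mult:
  fixes \<phi> :: "complex \<Rightarrow> 'b::{real_normed_field, banach, second_countable_topology}"
  assumes k: "k \<in> I"
    and \<phi>: "\<phi> \<in> borel_measurable circle_measure" "\<And>z. norm z = 1 \<Longrightarrow> norm (\<phi> z) \<le> B"
    and \<psi>: "\<psi> \<in> borel_measurable (torus I)" "\<And>\<zeta>. \<zeta> \<in> space (torus I) \<Longrightarrow> norm (\<psi> \<zeta>) \<le> C"
    and indep: "\<And>\<zeta> x. \<psi> (\<zeta>(k := x)) = \<psi> \<zeta>"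
  shows "(LINT \<zeta>|torus I. \<phi> (\<zeta> k) * \<psi> \<zeta>) =
    (LINT z|circle_measure. \<phi> z) * (LINT \<zeta>|torus I. \<psi> \<zeta>)"
proof -
  interpret P: pair_prob_space circle_measure "torus I" ..
  let ?P = "circle_measure \<Otimes>\<^sub>M torus I"
  have [measurable]: "\<phi> \<in> borel_measurable circle_measure" "\<psi> \<in> borel_measurable (torus I)"
    by fact+
  have I: "insert k I = I" using k by auto
  have eq: "distr ?P (torus I) (\<lambda>(x, X). X(k := x)) = torus I"
    using distr_pair_PiM_eq_PiM[of I "\<lambda>_. circle_measure" k] prob_space_circle_measure I
    by (simp add: torus_def)
  have meas: "(\<lambda>(x, X). X(k := x)) \<in> ?P \<rightarrow>\<^sub>M torus I"
    unfolding torus_def case_prod_beta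
    by (rule measurable_fun_upd[where J = I]) (use k in auto)
  have [measurable]: "(\<lambda>\<zeta>. \<phi> (\<zeta> k)) \<in> borel_measurable (torus I)"
    by (rule measurable_torus_coord) fact+
  have "(LINT \<zeta>|torus I. \<phi> (\<zeta> k) * \<psi> \<zeta>) =
      (LINT \<zeta>|distr ?P (torus I) (\<lambda>(x, X). X(k := x)). \<phi> (\<zeta> k) * \<psi> \<zeta>)"
    by (simp only: eq)
  also have "\<dots> = (LINT p|?P. \<phi> (fst p) * \<psi> (snd p))"
    using meas by (subst integral_distr) (auto simp: case_prod_beta indep)
  also have "\<dots> = (LINT x|circle_measure. LINT X|torus I. \<phi> x * \<psi> X)"
  proof (subst P.integral_fst'[symmetric])
    have "AE p in ?P. norm (\<phi> (fst p) * \<psi> (snd p)) \<le> \<bar>B\<bar> * \<bar>C\<bar>"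
    proof (rule AE_I2)
      fix p assume "p \<in> space ?P"
      then have "norm (\<phi> (fst p)) \<le> \<bar>B\<bar>" "norm (\<psi> (snd p)) \<le> \<bar>C\<bar>"
        using \<phi>(2) \<psi>(2) by (force simp: space_pair_measure)+
      then show "norm (\<phi> (fst p) * \<psi> (snd p)) \<le> \<bar>B\<bar> * \<bar>C\<bar>"
        by (simp add: norm_mult mult_mono')
    qed
    then show "integrable ?P (\<lambda>p. \<phi> (fst p) * \<psi> (snd p))"
      by (intro P.integrable_const_bound) auto
  qed simp
  also have "\<dots> = (LINT z|circle_measure. \<phi> z) * (LINT \<zeta>|torus I. \<psi> \<zeta>)"
    by simp
  finally show ?thesis .
qed

subsection \<open>Fourier coefficients\<close>

lemma borel_measurable_cnj [measurable (raw)]: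
  "f \<in> borel_measurable M \<Longrightarrow> (\<lambda>x. cnj (f x)) \<in> borel_measurable M"
  by (rule measurable_compose[where g = cnj and N = borel])
     (auto intro: borel_measurable_continuous_onI continuous_intros)

lemma character_eq_prod:
  assumes "finite S" "{i. \<alpha> i \<noteq> 0} \<subseteq> S"
  shows "character \<alpha> \<zeta> = (\<Prod>i\<in>S. \<zeta> i powi \<alpha> i)"
  unfolding character_def using assms by (intro prod.mono_neutral_left) auto

lemma character_measurable:
  assumes "\<alpha> \<in> multi_indices I"
  shows "character \<alpha> \<in> borel_measurable (torus I)"
  unfolding character_def[abs_def] using assms
  by (intro borel_measurable_prod measurable_torus_coord[where f = "\<lambda>z. z powi _"]
      measurable_circle_borel continuous_on_circle_powi)
     (auto simp: multi_indices_def)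

lemma norm_character:
  assumes "\<alpha> \<in> multi_indices I" "\<zeta> \<in> space (torus I)"
  shows "norm (character \<alpha> \<zeta>) = 1"
  using assms unfolding character_def prod_norm[symmetric]
  by (intro prod.neutral) (auto simp: multi_indices_def norm_power_int space_torusD subset_iff)

lemma multi_indices_combine:
  assumes "\<alpha> \<in> multi_indices I" "\<beta> \<in> multi_indices I" "op 0 0 = 0"
  shows "(\<lambda>i. op (\<alpha> i) (\<beta> i)) \<in> multi_indices I"
proof -
  have "{i. op (\<alpha> i) (\<beta> i) \<noteq> 0} \<subseteq> {i. \<alpha> i \<noteq> 0} \<union> {i. \<beta> i \<noteq> 0}"
    using assms(3) by auto
  then show ?thesis
    using assms(1,2) unfolding multi_indices_def
    by (auto intro: finite_subset[OF \<open>_ \<subseteq> _\<close>])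
qed

lemma character_add:
  assumes \<alpha>: "\<alpha> \<in> multi_indices I" and \<beta>: "\<beta> \<in> multi_indices I" and \<zeta>: "\<zeta> \<in> space (torus I)"
  shows "character (\<lambda>i. \<alpha> i + \<beta> i) \<zeta> = character \<alpha> \<zeta> * character \<beta> \<zeta>"
proof -
  let ?S = "{i. \<alpha> i \<noteq> 0} \<union> {i. \<beta> i \<noteq> 0}"
  have S: "finite ?S" "?S \<subseteq> I" using \<alpha> \<beta> by (auto simp: multi_indices_def)
  have "\<zeta> i \<noteq> 0" if "i \<in> ?S" for i
    using S that space_torusD[OF \<zeta>, of i] by fastforce
  then have "(\<Prod>i\<in>?S. \<zeta> i powi (\<alpha> i + \<beta> i)) = (\<Prod>i\<in>?S. \<zeta> i powi \<alpha> i * \<zeta> i powi \<beta> i)"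
    by (intro prod.cong) (auto simp: power_int_add)
  then show ?thesis
    using S by (subst (1 2 3) character_eq_prod[of ?S]) (auto simp: prod.distrib)
qed

lemma cnj_character:
  assumes \<alpha>: "\<alpha> \<in> multi_indices I" and \<zeta>: "\<zeta> \<in> space (torus I)"
  shows "cnj (character \<alpha> \<zeta>) = character (\<lambda>i. - \<alpha> i) \<zeta>"
proof -
  have "cnj (\<zeta> i powi \<alpha> i) = \<zeta> i powi (- \<alpha> i)" if "\<alpha> i \<noteq> 0" for i
  proof -
    have "norm (\<zeta> i) = 1" using that \<alpha> \<zeta> by (auto simp: multi_indices_def intro: space_torusD)
    then have "\<zeta> i * cnj (\<zeta> i) = 1" by (simp flip: complex_norm_square)
    then have "inverse (\<zeta> i) = cnj (\<zeta> i)" by (rule inverse_unique)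
    then show ?thesis by (simp add: power_int_minus flip: power_int_inverse)
  qed
  then show ?thesis by (simp add: character_def)
qed

text \<open>Some coordinate \<open>k\<close> has a nonzero exponent and is independent of all other
  factors, so its factor integrates to 0.\<close>

lemma integral_character:
  assumes "\<alpha> \<in> multi_indices I" "\<alpha> \<noteq> (\<lambda>_. 0)"
  shows "(LINT \<zeta>|torus I. character \<alpha> \<zeta>) = 0"
proof -
  obtain k where k: "\<alpha> k \<noteq> 0" using assms(2) by auto
  let ?\<beta> = "\<alpha>(k := 0)"
  have \<beta>: "?\<beta> \<in> multi_indices I"
    using assms(1) by (auto simp: multi_indices_def elim!: finite_subset[rotated])
  have kI: "k \<in> I" using k assms(1) by (auto simp: multi_indices_def)
  have "character \<alpha> \<zeta> = \<zeta> k powi \<alpha> k * character ?\<beta> \<zeta>" for \<zeta>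
  proof -
    have "{i. \<alpha> i \<noteq> 0} = insert k {i. ?\<beta> i \<noteq> 0}" "k \<notin> {i. ?\<beta> i \<noteq> 0}" using k by auto
    moreover have "finite {i. ?\<beta> i \<noteq> 0}" using \<beta> by (simp add: multi_indices_def)
    moreover have "(\<Prod>i | ?\<beta> i \<noteq> 0. \<zeta> i powi \<alpha> i) = (\<Prod>i | ?\<beta> i \<noteq> 0. \<zeta> i powi ?\<beta> i)"
      by (rule prod.cong) auto
    ultimately show ?thesis unfolding character_def by (simp del: fun_upd_apply)
  qed
  then have "(LINT \<zeta>|torus I. character \<alpha> \<zeta>) = (LINT \<zeta>|torus I. \<zeta> k powi \<alpha> k * character ?\<beta> \<zeta>)"
    by simp
  moreover have indep: "character ?\<beta> (\<zeta>(k := x)) = character ?\<beta> \<zeta>" for \<zeta> x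
    unfolding character_def by (rule prod.cong) auto
  have "(LINT \<zeta>|torus I. \<zeta> k powi \<alpha> k * character ?\<beta> \<zeta>) =
      (LINT z|circle_measure. z powi \<alpha> k) * (LINT \<zeta>|torus I. character ?\<beta> \<zeta>)"
    by (rule torus_integral_mult[where \<phi> = "\<lambda>z. z powi \<alpha> k" and B = 1 and C = 1])
       (use kI \<beta> indep in \<open>auto intro!: measurable_circle_borel continuous_on_circle_powi character_measurable
           simp: norm_power_int norm_character simp del: fun_upd_apply\<close>)
  ultimately show ?thesis using k by (simp add: circle_integral_powi)
qed

lemma integral_character_mult_cnj:
  assumes "\<alpha> \<in> multi_indices I" "\<beta> \<in> multi_indices I"
  shows "(LINT \<zeta>|torus I. character \<alpha> \<zeta> * cnj (character \<beta> \<zeta>)) = (if \<alpha> = \<beta> then 1 else 0)"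
proof -
  have \<beta>': "(\<lambda>i. - \<beta> i) \<in> multi_indices I" using assms(2) by (auto simp: multi_indices_def)
  have d: "(\<lambda>i. \<alpha> i + - \<beta> i) \<in> multi_indices I"
    using multi_indices_combine[OF assms(1) \<beta>', of "(+)"] by simp
  have "(LINT \<zeta>|torus I. character \<alpha> \<zeta> * cnj (character \<beta> \<zeta>)) =
      (LINT \<zeta>|torus I. character (\<lambda>i. \<alpha> i + - \<beta> i) \<zeta>)"
    by (rule Bochner_Integration.integral_cong)
       (simp_all only: character_add[OF assms(1) \<beta>'] cnj_character[OF assms(2)])
  also have "\<dots> = (if \<alpha> = \<beta> then 1 else 0)"
  proof (cases "\<alpha> = \<beta>")
    case True
    then show ?thesis by (simp add: character_def torus.prob_space)
  next
    case False
    then have "(\<lambda>i. \<alpha> i + - \<beta> i) \<noteq> (\<lambda>_. 0)" by (auto simp: fun_eq_iff)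
    then show ?thesis using integral_character[OF d] False by simp
  qed
  finally show ?thesis .
qed

text \<open>With \<open>c = fourier_coeff I f\<close> this is a partial sum in
  \<open>has_riesz_projection\<close>. Free coefficients let differences of partial sums and
  explicit polynomials take the same form.\<close>

definition trig_sum :: "(nat \<Rightarrow> int) set \<Rightarrow> ((nat \<Rightarrow> int) \<Rightarrow> complex) \<Rightarrow> (nat \<Rightarrow> complex) \<Rightarrow> complex"
  where "trig_sum F c \<zeta> = (\<Sum>\<alpha>\<in>F. c \<alpha> * character \<alpha> \<zeta>)"

lemma trig_sum_measurable:
  assumes "F \<subseteq> multi_indices I"
  shows "trig_sum F c \<in> borel_measurable (torus I)"
  unfolding trig_sum_def[abs_def] using assms
  by (intro borel_measurable_sum borel_measurable_times character_measurable) auto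

lemma norm_trig_sum_le:
  assumes "F \<subseteq> multi_indices I" "\<zeta> \<in> space (torus I)"
  shows "norm (trig_sum F c \<zeta>) \<le> (\<Sum>\<alpha>\<in>F. norm (c \<alpha>))"
  unfolding trig_sum_def using assms
  by (intro sum_norm_le) (auto simp: norm_mult norm_character subset_iff)

lemma integrable_bounded_torus:
  fixes f :: "(nat \<Rightarrow> complex) \<Rightarrow> 'b::{banach, second_countable_topology}"
  assumes "f \<in> borel_measurable (torus I)" "\<And>\<zeta>. \<zeta> \<in> space (torus I) \<Longrightarrow> norm (f \<zeta>) \<le> B"
  shows "integrable (torus I) f"
  using assms by (intro torus.integrable_const_bound[where B = B]) auto

lemma fourier_coeff_trig_sum:
  assumes "finite F" "F \<subseteq> multi_indices I" "\<beta> \<in> multi_indices I"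
  shows "fourier_coeff I (trig_sum F c) \<beta> = (if \<beta> \<in> F then c \<beta> else 0)"
proof -
  have int: "integrable (torus I) (\<lambda>\<zeta>. character \<alpha> \<zeta> * cnj (character \<beta> \<zeta>))" if "\<alpha> \<in> F" for \<alpha>
    using that assms
    by (intro integrable_bounded_torus[where B = 1])
       (auto intro!: borel_measurable_times character_measurable borel_measurable_cnj
          simp: norm_mult norm_character)
  have "fourier_coeff I (trig_sum F c) \<beta> =
      (LINT \<zeta>|torus I. (\<Sum>\<alpha>\<in>F. c \<alpha> * (character \<alpha> \<zeta> * cnj (character \<beta> \<zeta>))))"
    by (simp add: fourier_coeff_def trig_sum_def sum_distrib_right mult.assoc)
  also have "\<dots> = (\<Sum>\<alpha>\<in>F. c \<alpha> * (if \<alpha> = \<beta> then 1 else 0))"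
    using assms int by (subst Bochner_Integration.integral_sum)
      (auto intro!: sum.cong simp: integral_character_mult_cnj)
  finally show ?thesis using assms(1) by (simp add: sum.delta' if_distrib cong: if_cong)
qed

text \<open>The bound on \<open>f\<close> is asked almost everywhere, since that is what an
  essential supremum provides. With \<open>f = trig_sum F c\<close> the identity becomes Parseval's
  formula.\<close>

lemma integral_mult_cnj_trig_sum:
  assumes F: "F \<subseteq> multi_indices I" and f: "f \<in> borel_measurable (torus I)"
    and B: "AE \<zeta> in torus I. norm (f \<zeta>) \<le> B"
  shows "(LINT \<zeta>|torus I. f \<zeta> * cnj (trig_sum F c \<zeta>)) =
    (\<Sum>\<alpha>\<in>F. fourier_coeff I f \<alpha> * cnj (c \<alpha>))"
proof -
  have "integrable (torus I) (\<lambda>\<zeta>. f \<zeta> * cnj (character \<alpha> \<zeta>))" if "\<alpha> \<in> F" for \<alpha>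
  proof (rule torus.integrable_const_bound[where B = B])
    show "AE \<zeta> in torus I. norm (f \<zeta> * cnj (character \<alpha> \<zeta>)) \<le> B"
      using B by (rule AE_mp) (use that F in \<open>auto simp: norm_mult norm_character\<close>)
    show "(\<lambda>\<zeta>. f \<zeta> * cnj (character \<alpha> \<zeta>)) \<in> borel_measurable (torus I)"
      using that F f by (auto intro!: borel_measurable_times character_measurable borel_measurable_cnj)
  qed
  then have "(LINT \<zeta>|torus I. (\<Sum>\<alpha>\<in>F. cnj (c \<alpha>) * (f \<zeta> * cnj (character \<alpha> \<zeta>)))) =
      (\<Sum>\<alpha>\<in>F. cnj (c \<alpha>) * fourier_coeff I f \<alpha>)"
    by (subst Bochner_Integration.integral_sum) (auto simp: fourier_coeff_def)
  then show ?thesis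
    by (simp add: trig_sum_def sum_distrib_left mult_ac)
qed

lemma integral_norm_trig_sum:
  assumes F: "finite F" "F \<subseteq> multi_indices I"
  shows "(LINT \<zeta>|torus I. (norm (trig_sum F c \<zeta>))\<^sup>2) = (\<Sum>\<alpha>\<in>F. (norm (c \<alpha>))\<^sup>2)"
proof -
  have "of_real (LINT \<zeta>|torus I. (norm (trig_sum F c \<zeta>))\<^sup>2) =
      (LINT \<zeta>|torus I. trig_sum F c \<zeta> * cnj (trig_sum F c \<zeta>))"
    by (simp add: flip: complex_norm_square of_real_power integral_complex_of_real)
  also have "\<dots> = (\<Sum>\<alpha>\<in>F. fourier_coeff I (trig_sum F c) \<alpha> * cnj (c \<alpha>))"
    using F 
    by (intro integral_mult_cnj_trig_sum[where B = "\<Sum>\<alpha>\<in>F. norm (c \<alpha>)"] trig_sum_measurable AE_I2 norm_trig_sum_le)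
  also have "\<dots> = (\<Sum>\<alpha>\<in>F. c \<alpha> * cnj (c \<alpha>))"
    using F by (intro sum.cong) (auto simp: fourier_coeff_trig_sum subset_iff)
  also have "\<dots> = of_real (\<Sum>\<alpha>\<in>F. (norm (c \<alpha>))\<^sup>2)"
    by (simp flip: complex_norm_square)
  finally show ?thesis by (simp only: of_real_eq_iff)
qed

lemma nn_integral_norm_trig_sum:
  assumes F: "finite F" "F \<subseteq> multi_indices I"
  shows "(\<integral>\<^sup>+\<zeta>. ennreal ((norm (trig_sum F c \<zeta>))\<^sup>2) \<partial>torus I) =
    ennreal (\<Sum>\<alpha>\<in>F. (norm (c \<alpha>))\<^sup>2)"
proof -
  note [measurable] = trig_sum_measurable[OF F(2), of c]
  have "integrable (torus I) (\<lambda>\<zeta>. (norm (trig_sum F c \<zeta>))\<^sup>2)"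
    using F by (intro integrable_bounded_torus[where B = "(\<Sum>\<alpha>\<in>F. norm (c \<alpha>))\<^sup>2"])
      (auto intro!: power_mono norm_trig_sum_le)
  then show ?thesis
    using F by (subst nn_integral_eq_integral) (auto simp: integral_norm_trig_sum)
qed

text \<open>Expanding the nonnegative integral of \<open>|f - S|^2\<close>, where \<open>S\<close>
  is the partial sum, gives the integral of \<open>|f|^2\<close> minus \<open>?s\<close>; on a
  probability space the former is at most \<open>B^2\<close>.\<close>

lemma bessel_inequality:
  assumes F: "finite F" "F \<subseteq> multi_indices I" and f: "f \<in> borel_measurable (torus I)"
    and B: "AE \<zeta> in torus I. norm (f \<zeta>) \<le> B"
  shows "(\<Sum>\<alpha>\<in>F. (norm (fourier_coeff I f \<alpha>))\<^sup>2) \<le> B\<^sup>2"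
proof -
  let ?c = "fourier_coeff I f" let ?S = "trig_sum F ?c" let ?s = "\<Sum>\<alpha>\<in>F. (norm (?c \<alpha>))\<^sup>2"
  let ?C = "\<Sum>\<alpha>\<in>F. norm (?c \<alpha>)"
  note [measurable] = f trig_sum_measurable[OF F(2), of ?c]
  have i1: "integrable (torus I) (\<lambda>\<zeta>. (norm (f \<zeta>))\<^sup>2)"
    by (rule torus.integrable_const_bound[where B = "B\<^sup>2"])
       (use B in \<open>auto elim!: eventually_mono intro!: power_mono\<close>)
  have i2: "integrable (torus I) (\<lambda>\<zeta>. (norm (?S \<zeta>))\<^sup>2)"
    by (rule torus.integrable_const_bound[where B = "?C\<^sup>2"])
       (use F in \<open>auto intro!: AE_I2 power_mono norm_trig_sum_le\<close>)
  have i3: "integrable (torus I) (\<lambda>\<zeta>. f \<zeta> * cnj (?S \<zeta>))"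
  proof (rule torus.integrable_const_bound[where B = "B * ?C"])
    show "AE \<zeta> in torus I. norm (f \<zeta> * cnj (?S \<zeta>)) \<le> B * ?C"
      using B by (rule AE_mp)
        (use F in \<open>auto intro!: AE_I2 simp: norm_mult intro!: mult_mono' norm_trig_sum_le\<close>)
  qed simp
  have "of_real ?s = (\<Sum>\<alpha>\<in>F. ?c \<alpha> * cnj (?c \<alpha>))"
    by (simp flip: complex_norm_square)
  also have "\<dots> = (LINT \<zeta>|torus I. f \<zeta> * cnj (?S \<zeta>))"
    using F f B by (subst integral_mult_cnj_trig_sum) auto
  finally have s: "of_real ?s = (LINT \<zeta>|torus I. f \<zeta> * cnj (?S \<zeta>))" .
  \<comment> \<open>Only the real part of the cross term enters \<open>|f - S|^2\<close>. Its
    integral is all of \<open>?s\<close>, because the complex integral in \<open>s\<close> is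
    already real.\<close>
  define R where "R \<zeta> = Re (f \<zeta> * cnj (?S \<zeta>))" for \<zeta>
  have R: "integrable (torus I) R" "(LINT \<zeta>|torus I. R \<zeta>) = ?s"
    unfolding R_def integral_Re[OF i3] s[symmetric] using integrable_Re[OF i3] by simp_all
  have "0 \<le> (LINT \<zeta>|torus I. (norm (f \<zeta> - ?S \<zeta>))\<^sup>2)" by simp
  also have "(\<lambda>\<zeta>. (norm (f \<zeta> - ?S \<zeta>))\<^sup>2) =
      (\<lambda>\<zeta>. (norm (f \<zeta>))\<^sup>2 + (norm (?S \<zeta>))\<^sup>2 - 2 * R \<zeta>)"
    unfolding cmod_power2 R_def by (simp add: fun_eq_iff power2_eq_square algebra_simps)
  also have "(LINT \<zeta>|torus I. (norm (f \<zeta>))\<^sup>2 + (norm (?S \<zeta>))\<^sup>2 - 2 * R \<zeta>) =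
      (LINT \<zeta>|torus I. (norm (f \<zeta>))\<^sup>2) + ?s - 2 * ?s"
    using i1 i2 R F by (simp add: integral_norm_trig_sum)
  finally have "?s \<le> (LINT \<zeta>|torus I. (norm (f \<zeta>))\<^sup>2)" by simp
  also have "\<dots> \<le> (LINT \<zeta>|torus I. B\<^sup>2)"
    using i1 B by (intro integral_mono_AE) (auto elim!: eventually_mono intro!: power_mono)
  finally show ?thesis by (simp add: torus.prob_space)
qed

subsection \<open>Existence and contractivity on \<open>L\<^sup>2\<close>\<close>

text \<open>In the difference the coefficients on \<open>K\<close> cancel and every other one is
  \<open>c \<alpha>\<close>, \<open>- c \<alpha>\<close> or 0, so Parseval's formula bounds the
  integral by the sum outside \<open>K\<close>.\<close>

lemma nn_integral_trig_sum_diff_le: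
  assumes H: "finite H" "H \<subseteq> multi_indices I" and H': "finite H'" "H' \<subseteq> multi_indices I"
    and K: "K \<subseteq> H \<inter> H'"
  shows "(\<integral>\<^sup>+\<zeta>. ennreal ((norm (trig_sum H c \<zeta> - trig_sum H' c \<zeta>))\<^sup>2) \<partial>torus I) \<le>
    ennreal ((\<Sum>\<alpha>\<in>H \<union> H'. (norm (c \<alpha>))\<^sup>2) - (\<Sum>\<alpha>\<in>K. (norm (c \<alpha>))\<^sup>2))"
proof -
  let ?d = "\<lambda>\<alpha>. ((if \<alpha> \<in> H then 1 else 0) - (if \<alpha> \<in> H' then 1 else 0)) * c \<alpha>"
  have fin: "finite (H \<union> H')" using H H' by simp
  have "trig_sum H c \<zeta> - trig_sum H' c \<zeta> = trig_sum (H \<union> H') ?d \<zeta>" for \<zeta>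
  proof -
    have "trig_sum H c \<zeta> = (\<Sum>\<alpha>\<in>H \<union> H'. (if \<alpha> \<in> H then c \<alpha> * character \<alpha> \<zeta> else 0))"
      "trig_sum H' c \<zeta> = (\<Sum>\<alpha>\<in>H \<union> H'. (if \<alpha> \<in> H' then c \<alpha> * character \<alpha> \<zeta> else 0))"
      unfolding trig_sum_def using fin
      by (simp_all flip: sum.inter_restrict add: Int_absorb1)
    then show ?thesis
      unfolding trig_sum_def by (auto simp flip: sum_subtractf intro!: sum.cong)
  qed
  then have "(\<integral>\<^sup>+\<zeta>. ennreal ((norm (trig_sum H c \<zeta> - trig_sum H' c \<zeta>))\<^sup>2) \<partial>torus I) =
      ennreal (\<Sum>\<alpha>\<in>H \<union> H'. (norm (?d \<alpha>))\<^sup>2)"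
    using H H' by (simp only: nn_integral_norm_trig_sum finite_UnI Un_least)
  also have "(\<Sum>\<alpha>\<in>H \<union> H'. (norm (?d \<alpha>))\<^sup>2) \<le> (\<Sum>\<alpha>\<in>(H \<union> H') - K. (norm (c \<alpha>))\<^sup>2)"
  proof -
    have "(\<Sum>\<alpha>\<in>H \<union> H'. (norm (?d \<alpha>))\<^sup>2) = (\<Sum>\<alpha>\<in>(H \<union> H') - K. (norm (?d \<alpha>))\<^sup>2)"
      using fin K by (intro sum.mono_neutral_right) auto
    also have "\<dots> \<le> (\<Sum>\<alpha>\<in>(H \<union> H') - K. (norm (c \<alpha>))\<^sup>2)"
      by (intro sum_mono) auto
    finally show ?thesis .
  qed
  also have "\<dots> = (\<Sum>\<alpha>\<in>H \<union> H'. (norm (c \<alpha>))\<^sup>2) - (\<Sum>\<alpha>\<in>K. (norm (c \<alpha>))\<^sup>2)"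
    using fin K by (intro sum_diff) auto
  finally show ?thesis by (simp add: ennreal_leI)
qed

text \<open>Square-summable coefficients give a rapidly Cauchy sequence of partial sums, which
  converges almost everywhere, and Fatou's lemma carries the L^2 estimates over to the limit. The
  limit is taken along a sequence, but the conclusion covers the whole net of finite sets.\<close>

lemma riesz_fischer:
  assumes A: "A \<subseteq> multi_indices I"
    and bdd: "\<And>F. finite F \<Longrightarrow> F \<subseteq> A \<Longrightarrow> (\<Sum>\<alpha>\<in>F. (norm (c \<alpha>))\<^sup>2) \<le> B"
  obtains g where "g \<in> borel_measurable (torus I)"
    "\<And>e. e > 0 \<Longrightarrow> \<exists>F0. finite F0 \<and> F0 \<subseteq> A \<and> (\<forall>F. finite F \<longrightarrow> F0 \<subseteq> F \<longrightarrow> F \<subseteq> A \<longrightarrow>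
      (\<integral>\<^sup>+\<zeta>. ennreal ((norm (g \<zeta> - trig_sum F c \<zeta>))\<^sup>2) \<partial>torus I) \<le> ennreal e)"
proof -
  let ?s2 = "\<lambda>F. \<Sum>\<alpha>\<in>F. (norm (c \<alpha>))\<^sup>2"
  have "(\<lambda>\<alpha>. (norm (c \<alpha>))\<^sup>2) summable_on A"
    using bdd by (intro nonneg_bdd_above_summable_on bdd_aboveI[of _ B]) auto
  then obtain s where s: "((\<lambda>\<alpha>. (norm (c \<alpha>))\<^sup>2) has_sum s) A"
    by (auto simp: summable_on_def)
  \<comment> \<open>The rate 1/4 is for squared norms: it yields increments of size
    \<open>(1/2)^k\<close> in L^1, which are summable. The extra power in \<open>Suc k\<close>
    absorbs the two errors that are added in \<open>close\<close>.\<close>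
  have "\<exists>F0. finite F0 \<and> F0 \<subseteq> A \<and> (\<forall>F. finite F \<longrightarrow> F0 \<subseteq> F \<longrightarrow> F \<subseteq> A \<longrightarrow> dist (?s2 F) s < (1/4)^Suc k)" for k :: nat
  proof -
    have "\<forall>\<^sub>F F in finite_subsets_at_top A. dist (?s2 F) s < (1/4)^Suc k"
      using s unfolding has_sum_def tendsto_iff by (auto simp del: power_Suc)
    then obtain X where "finite X" "X \<subseteq> A"
        "\<And>Y. finite Y \<and> X \<subseteq> Y \<and> Y \<subseteq> A \<Longrightarrow> dist (?s2 Y) s < (1/4)^Suc k"
      unfolding eventually_finite_subsets_at_top by auto
    then show ?thesis by (intro exI[of _ X] conjI allI impI) auto
  qed
  then obtain F0 where F0: "\<And>k. finite (F0 k)" "\<And>k. F0 k \<subseteq> A"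
      "\<And>k F. finite F \<Longrightarrow> F0 k \<subseteq> F \<Longrightarrow> F \<subseteq> A \<Longrightarrow> dist (?s2 F) s < (1/4)^Suc k"
    by metis
  \<comment> \<open>The unions make the index sets increase, so that later partial sums contain all
    earlier frequencies.\<close>
  define G where "G k = (\<Union>i\<le>k. F0 i)" for k
  have G: "finite (G k)" "G k \<subseteq> A" for k
    using F0(1,2) by (auto simp: G_def)
  then have G_multi: "G k \<subseteq> multi_indices I" for k
    using A by blast
  have G_mono: "G k \<subseteq> G j" if "k \<le> j" for k j using that by (force simp: G_def)
  define S where "S k = trig_sum (G k) c" for k
  have S_meas [measurable]: "S k \<in> borel_measurable (torus I)" for k
    unfolding S_def using G_multi by (intro trig_sum_measurable)
  have close: "(\<integral>\<^sup>+\<zeta>. ennreal ((norm (trig_sum H c \<zeta> - trig_sum H' c \<zeta>))\<^sup>2) \<partial>torus I) \<le> ennreal ((1/4)^k)"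
    if "finite H" "finite H'" "H \<subseteq> A" "H' \<subseteq> A" "G k \<subseteq> H" "G k \<subseteq> H'" for H H' k
  proof -
    have "F0 k \<subseteq> G k" by (auto simp: G_def)
    then have "dist (?s2 (H \<union> H')) s < (1/4)^Suc k" "dist (?s2 (G k)) s < (1/4)^Suc k"
      using that G[of k] by (intro F0(3); auto)+
    then have "?s2 (H \<union> H') - ?s2 (G k) \<le> (1/4)^k"
      unfolding dist_real_def power_Suc by linarith
    then show ?thesis
      using that A by (intro order_trans[OF nn_integral_trig_sum_diff_le[of H I H' "G k" c]] ennreal_leI) auto
  qed
  have incr: "(\<integral>\<^sup>+\<zeta>. ennreal (norm (S (Suc k) \<zeta> - S k \<zeta>)) \<partial>torus I) \<le> ennreal ((1/2)^k)" for k
  proof -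
    let ?D = "\<lambda>\<zeta>. norm (S (Suc k) \<zeta> - S k \<zeta>)"
    \<comment> \<open>AM-GM with the weight \<open>x = (1/2)^k\<close> turns the bound
      \<open>(1/4)^k\<close> on the squared L^2 norm into the bound \<open>(1/2)^k\<close> on the
      L^1 norm.\<close>
    have "?D \<zeta> \<le> (1/2)^k / 2 + 2^k / 2 * (?D \<zeta>)\<^sup>2" for \<zeta>
    proof -
      define x :: real where "x = (1/2)^k"
      have x: "x > 0" "2^k = 1 / x" by (simp_all add: x_def power_one_over)
      have "0 \<le> (x - ?D \<zeta>)\<^sup>2 / (2 * x)" using x by simp
      also have "\<dots> = x / 2 + 2^k / 2 * (?D \<zeta>)\<^sup>2 - ?D \<zeta>"
        using x(1) unfolding x(2) by (simp add: power2_eq_square field_simps)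
      finally show ?thesis by (simp add: x_def)
    qed
    then have "(\<integral>\<^sup>+\<zeta>. ennreal (?D \<zeta>) \<partial>torus I) \<le>
        (\<integral>\<^sup>+\<zeta>. ennreal ((1/2)^k / 2) + ennreal (2^k / 2) * ennreal ((?D \<zeta>)\<^sup>2) \<partial>torus I)"
      by (intro nn_integral_mono) (simp flip: ennreal_mult ennreal_plus)
    also have "\<dots> = ennreal ((1/2)^k / 2) + ennreal (2^k / 2) * (\<integral>\<^sup>+\<zeta>. ennreal ((?D \<zeta>)\<^sup>2) \<partial>torus I)"
      by (simp add: nn_integral_add nn_integral_cmult torus.emeasure_space_1)
    also have "\<dots> \<le> ennreal ((1/2)^k / 2) + ennreal (2^k / 2) * ennreal ((1/4)^k)"
      unfolding S_def using G G_mono[of k "Suc k"] by (intro add_left_mono mult_left_mono close) auto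
    also have "\<dots> = ennreal ((1/2)^k / 2 + 2^k / 2 * (1/4)^k)"
      by (simp flip: ennreal_mult ennreal_plus)
    also have "(1/2)^k / 2 + 2^k / 2 * (1/4)^k = ((1/2)^k :: real)"
      by (simp flip: power_mult_distrib)
    finally show ?thesis .
  qed
  have "(\<integral>\<^sup>+\<zeta>. (\<Sum>k. ennreal (norm (S (Suc k) \<zeta> - S k \<zeta>))) \<partial>torus I) =
      (\<Sum>k. \<integral>\<^sup>+\<zeta>. ennreal (norm (S (Suc k) \<zeta> - S k \<zeta>)) \<partial>torus I)"
    by (rule nn_integral_suminf) simp
  also have "\<dots> \<le> (\<Sum>k. ennreal ((1/2)^k))"
    by (intro suminf_le incr) auto
  also have "\<dots> = ennreal (\<Sum>k. (1/2)^k)"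
    by (rule suminf_ennreal2) (auto intro: summable_geometric)
  finally have "(\<integral>\<^sup>+\<zeta>. (\<Sum>k. ennreal (norm (S (Suc k) \<zeta> - S k \<zeta>))) \<partial>torus I) \<noteq> \<infinity>"
    by (auto simp: top_unique)
  then have "AE \<zeta> in torus I. (\<Sum>k. ennreal (norm (S (Suc k) \<zeta> - S k \<zeta>))) \<noteq> \<infinity>"
    by (intro nn_integral_PInf_AE) auto
  then have conv: "AE \<zeta> in torus I. (\<lambda>k. S k \<zeta>) \<longlonglongrightarrow> lim (\<lambda>k. S k \<zeta>)"
  proof (rule eventually_mono)
    fix \<zeta> assume "(\<Sum>k. ennreal (norm (S (Suc k) \<zeta> - S k \<zeta>))) \<noteq> \<infinity>"
    then have "summable (\<lambda>k. norm (S (Suc k) \<zeta> - S k \<zeta>))"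
      by (intro summable_suminf_not_top) auto
    then have "summable (\<lambda>k. S (Suc k) \<zeta> - S k \<zeta>)" by (rule summable_norm_cancel)
    then have "convergent (\<lambda>n. \<Sum>k<n. S (Suc k) \<zeta> - S k \<zeta>)"
      by (simp add: summable_iff_convergent)
    then have "convergent (\<lambda>n. S n \<zeta> - S 0 \<zeta>)" by (simp add: sum_lessThan_telescope[of "\<lambda>k. S k \<zeta>"])
    then have "convergent (\<lambda>n. (S n \<zeta> - S 0 \<zeta>) + S 0 \<zeta>)" by (intro convergent_add convergent_const)
    then show "(\<lambda>k. S k \<zeta>) \<longlonglongrightarrow> lim (\<lambda>k. S k \<zeta>)" by (simp add: convergent_LIMSEQ_iff)
  qed
  let ?g = "\<lambda>\<zeta>. lim (\<lambda>k. S k \<zeta>)"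
  have g_meas [measurable]: "?g \<in> borel_measurable (torus I)"
    by (rule borel_measurable_lim_metric) simp
  \<comment> \<open>For \<open>j \<ge> k\<close> both \<open>G j\<close> and \<open>F\<close>
    contain \<open>G k\<close>, so \<open>close\<close> bounds all but finitely many terms of the
    sequence in Fatou's lemma.\<close>
  have fatou: "(\<integral>\<^sup>+\<zeta>. ennreal ((norm (?g \<zeta> - trig_sum F c \<zeta>))\<^sup>2) \<partial>torus I) \<le> ennreal ((1/4)^k)"
    if F: "finite F" "G k \<subseteq> F" "F \<subseteq> A" for F k
  proof -
    have [measurable]: "trig_sum F c \<in> borel_measurable (torus I)"
      using F A by (intro trig_sum_measurable) auto
    have "(\<integral>\<^sup>+\<zeta>. ennreal ((norm (?g \<zeta> - trig_sum F c \<zeta>))\<^sup>2) \<partial>torus I) =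
        (\<integral>\<^sup>+\<zeta>. liminf (\<lambda>j. ennreal ((norm (S j \<zeta> - trig_sum F c \<zeta>))\<^sup>2)) \<partial>torus I)"
      using conv
      by (intro nn_integral_cong_AE, elim eventually_mono)
         (intro lim_imp_Liminf[symmetric] tendsto_ennrealI tendsto_intros; simp)
    also have "\<dots> \<le> liminf (\<lambda>j. \<integral>\<^sup>+\<zeta>. ennreal ((norm (S j \<zeta> - trig_sum F c \<zeta>))\<^sup>2) \<partial>torus I)"
      by (rule nn_integral_liminf) simp
    also have "\<dots> \<le> limsup (\<lambda>j. \<integral>\<^sup>+\<zeta>. ennreal ((norm (S j \<zeta> - trig_sum F c \<zeta>))\<^sup>2) \<partial>torus I)"
      by (rule Liminf_le_Limsup) simp
    also have "\<dots> \<le> ennreal ((1/4)^k)"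
    proof (rule Limsup_bounded)
      show "\<forall>\<^sub>F j in sequentially.
          (\<integral>\<^sup>+\<zeta>. ennreal ((norm (S j \<zeta> - trig_sum F c \<zeta>))\<^sup>2) \<partial>torus I) \<le> ennreal ((1/4)^k)"
        using eventually_ge_at_top[of k]
        by (elim eventually_mono) (use F G G_mono in \<open>unfold S_def, intro close; simp\<close>)
    qed
    finally show ?thesis .
  qed
  show thesis
  proof (rule that[OF g_meas])
    fix e :: real assume "e > 0"
    then obtain k where "(1/4)^k < e" using real_arch_pow_inv[of e "1/4"] by auto
    then show "\<exists>F0. finite F0 \<and> F0 \<subseteq> A \<and> (\<forall>F. finite F \<longrightarrow> F0 \<subseteq> F \<longrightarrow> F \<subseteq> A \<longrightarrow>
      (\<integral>\<^sup>+\<zeta>. ennreal ((norm (?g \<zeta> - trig_sum F c \<zeta>))\<^sup>2) \<partial>torus I) \<le> ennreal e)"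
      using G[of k]
      by (intro exI[of _ "G k"] conjI allI impI order_trans[OF fatou ennreal_leI]) auto
  qed
qed

section \<open>The Riesz projection: characterisation, uniqueness, existence and
  contractivity\<close>

lemma Lp_norm_le_iff:
  assumes "p > 0" "e \<ge> 0"
  shows "Lp_norm M p f \<le> ennreal e \<longleftrightarrow> (\<integral>\<^sup>+x. ennreal (cmod (f x) powr p) \<partial>M) \<le> ennreal (e powr p)"
proof (cases "\<integral>\<^sup>+x. ennreal (cmod (f x) powr p) \<partial>M")
  case (real J)
  have "J powr (1 / p) \<le> e \<longleftrightarrow> J \<le> e powr p"
  proof
    assume "J powr (1 / p) \<le> e"
    then have "(J powr (1 / p)) powr p \<le> e powr p" using assms by (intro powr_mono2) auto
    then show "J \<le> e powr p" using assms real by (simp add: powr_powr)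
  next
    assume "J \<le> e powr p"
    then have "J powr (1 / p) \<le> (e powr p) powr (1 / p)" using assms real by (intro powr_mono2) auto
    then show "J powr (1 / p) \<le> e" using assms by (simp add: powr_powr)
  qed
  then show ?thesis using real assms by (simp add: Lp_norm_def)
next
  case top
  then show ?thesis by (simp add: Lp_norm_def top_unique)
qed

text \<open>The squared integral avoids the root in \<open>Lp_norm\<close>, and the explicit finite
  sets match the conclusion of \<open>riesz_fischer\<close>. Passing between the two forms replaces
  \<open>e\<close> by \<open>sqrt e\<close> or by \<open>e^2\<close>.\<close>

lemma has_riesz_projection_iff:
  "has_riesz_projection I f g \<longleftrightarrow> g \<in> borel_measurable (torus I) \<and>
    (\<forall>e>0. \<exists>F0. finite F0 \<and> F0 \<subseteq> nonneg_multi_indices I \<and>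
      (\<forall>F. finite F \<longrightarrow> F0 \<subseteq> F \<longrightarrow> F \<subseteq> nonneg_multi_indices I \<longrightarrow>
        (\<integral>\<^sup>+\<zeta>. ennreal ((norm (g \<zeta> - trig_sum F (fourier_coeff I f) \<zeta>))\<^sup>2) \<partial>torus I) \<le> ennreal e))"
proof -
  let ?N = "\<lambda>F. Lp_norm (torus I) 2 (\<lambda>\<zeta>. g \<zeta> - (\<Sum>\<alpha>\<in>F. fourier_coeff I f \<alpha> * character \<alpha> \<zeta>))"
  let ?J = "\<lambda>F. \<integral>\<^sup>+\<zeta>. ennreal ((norm (g \<zeta> - trig_sum F (fourier_coeff I f) \<zeta>))\<^sup>2) \<partial>torus I"
  let ?L = "finite_subsets_at_top (nonneg_multi_indices I)"
  have N: "?N F \<le> ennreal e \<longleftrightarrow> ?J F \<le> ennreal (e\<^sup>2)" if "e \<ge> 0" for F e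
    using that by (subst Lp_norm_le_iff) (simp_all add: trig_sum_def powr_numeral)
  have "(?N \<longlongrightarrow> 0) ?L \<longleftrightarrow> (\<forall>e>0. \<forall>\<^sub>F F in ?L. ?N F \<le> ennreal e)"
  proof
    assume lim: "(?N \<longlongrightarrow> 0) ?L"
    show "\<forall>e>0. \<forall>\<^sub>F F in ?L. ?N F \<le> ennreal e"
    proof (intro allI impI)
      fix e :: real assume "e > 0"
      then have "\<forall>\<^sub>F F in ?L. ?N F < ennreal e"
        by (intro order_tendstoD(2)[OF lim]) (simp add: ennreal_less_zero_iff)
      then show "\<forall>\<^sub>F F in ?L. ?N F \<le> ennreal e"
        by (rule eventually_mono) (rule less_imp_le)
    qed
  next
    assume *: "\<forall>e>0. \<forall>\<^sub>F F in ?L. ?N F \<le> ennreal e"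
    show "(?N \<longlongrightarrow> 0) ?L"
    proof (rule order_tendstoI)
      fix a :: ennreal assume "0 < a"
      then obtain b where b: "0 < b" "b < a" using dense by blast
      define e where "e = enn2real b"
      have "ennreal e = b" unfolding e_def
        by (rule ennreal_enn2real) (rule less_le_trans[OF b(2) top_greatest])
      then have e: "0 < ennreal e" "ennreal e < a" using b by simp_all
      then have "\<forall>\<^sub>F F in ?L. ?N F \<le> ennreal e" using * by (auto simp: ennreal_less_zero_iff)
      then show "\<forall>\<^sub>F F in ?L. ?N F < a" using e(2) by (auto elim!: eventually_mono)
    qed simp
  qed
  also have "\<dots> \<longleftrightarrow> (\<forall>e>0. \<forall>\<^sub>F F in ?L. ?J F \<le> ennreal e)"
  proof safe
    fix e :: real assume *: "\<forall>e>0. \<forall>\<^sub>F F in ?L. ?N F \<le> ennreal e" and "e > 0"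
    then have "\<forall>\<^sub>F F in ?L. ?N F \<le> ennreal (sqrt e)" by simp
    then show "\<forall>\<^sub>F F in ?L. ?J F \<le> ennreal e" using N[of "sqrt e"] \<open>e > 0\<close> by simp
  next
    fix e :: real assume *: "\<forall>e>0. \<forall>\<^sub>F F in ?L. ?J F \<le> ennreal e" and "e > 0"
    then have "\<forall>\<^sub>F F in ?L. ?J F \<le> ennreal (e\<^sup>2)" by simp
    then show "\<forall>\<^sub>F F in ?L. ?N F \<le> ennreal e" using N[of e] \<open>e > 0\<close> by simp
  qed
  finally show ?thesis
    unfolding has_riesz_projection_def eventually_finite_subsets_at_top by (simp only: imp_conjL)
qed

lemma has_riesz_projectionE:
  assumes "has_riesz_projection I f g" "e > 0"
  obtains F0 where "finite F0" "F0 \<subseteq> nonneg_multi_indices I"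
    "\<And>F. finite F \<Longrightarrow> F0 \<subseteq> F \<Longrightarrow> F \<subseteq> nonneg_multi_indices I \<Longrightarrow>
      (\<integral>\<^sup>+\<zeta>. ennreal ((norm (g \<zeta> - trig_sum F (fourier_coeff I f) \<zeta>))\<^sup>2) \<partial>torus I) \<le> ennreal e"
  using assms unfolding has_riesz_projection_iff by blast

lemma nonneg_multi_indices_subset: "nonneg_multi_indices I \<subseteq> multi_indices I"
  by (auto simp: nonneg_multi_indices_def)

text \<open>Both functions are close to the same partial sum over \<open>F1 \<union> F2\<close>. As
  \<open>riesz_projection\<close> is a choice by \<open>SOME\<close>, this is what identifies it
  almost everywhere with an explicitly computed projection.\<close>

lemma has_riesz_projection_unique:
  assumes g: "has_riesz_projection I f g" and h: "has_riesz_projection I f h"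
  shows "AE \<zeta> in torus I. g \<zeta> = h \<zeta>"
proof -
  have [measurable]: "g \<in> borel_measurable (torus I)" "h \<in> borel_measurable (torus I)"
    using g h by (auto simp: has_riesz_projection_def)
  have "(\<integral>\<^sup>+\<zeta>. ennreal ((norm (g \<zeta> - h \<zeta>))\<^sup>2) \<partial>torus I) \<le> 0 + ennreal e" if e: "e > 0" for e
  proof -
    let ?c = "fourier_coeff I f"
    \<comment> \<open>Both errors \<open>e/4\<close> are doubled by
      \<open>(x + y)^2 \<le> 2 x^2 + 2 y^2\<close>, and together they make up
      \<open>e\<close>.\<close>
    obtain F1 where F1: "finite F1" "F1 \<subseteq> nonneg_multi_indices I"
      "\<And>F. finite F \<Longrightarrow> F1 \<subseteq> F \<Longrightarrow> F \<subseteq> nonneg_multi_indices I \<Longrightarrow>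
        (\<integral>\<^sup>+\<zeta>. ennreal ((norm (g \<zeta> - trig_sum F ?c \<zeta>))\<^sup>2) \<partial>torus I) \<le> ennreal (e/4)"
      by (rule has_riesz_projectionE[OF g, of "e/4"]) (use e in auto)
    obtain F2 where F2: "finite F2" "F2 \<subseteq> nonneg_multi_indices I"
      "\<And>F. finite F \<Longrightarrow> F2 \<subseteq> F \<Longrightarrow> F \<subseteq> nonneg_multi_indices I \<Longrightarrow>
        (\<integral>\<^sup>+\<zeta>. ennreal ((norm (h \<zeta> - trig_sum F ?c \<zeta>))\<^sup>2) \<partial>torus I) \<le> ennreal (e/4)"
      by (rule has_riesz_projectionE[OF h, of "e/4"]) (use e in auto)
    let ?S = "trig_sum (F1 \<union> F2) ?c"
    have [measurable]: "?S \<in> borel_measurable (torus I)"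
      using F1(2) F2(2) nonneg_multi_indices_subset[of I] by (intro trig_sum_measurable) blast
    have "(norm (g \<zeta> - h \<zeta>))\<^sup>2 \<le> 2 * (norm (g \<zeta> - ?S \<zeta>))\<^sup>2 + 2 * (norm (h \<zeta> - ?S \<zeta>))\<^sup>2" for \<zeta>
    proof -
      have "norm (g \<zeta> - h \<zeta>) \<le> norm (g \<zeta> - ?S \<zeta>) + norm (h \<zeta> - ?S \<zeta>)"
        using norm_triangle_ineq4[of "g \<zeta> - ?S \<zeta>" "h \<zeta> - ?S \<zeta>"] by simp
      then have "(norm (g \<zeta> - h \<zeta>))\<^sup>2 \<le> (norm (g \<zeta> - ?S \<zeta>) + norm (h \<zeta> - ?S \<zeta>))\<^sup>2"
        by (intro power_mono) auto
      also have "\<dots> \<le> 2 * (norm (g \<zeta> - ?S \<zeta>))\<^sup>2 + 2 * (norm (h \<zeta> - ?S \<zeta>))\<^sup>2"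
        using sum_squares_bound[of "norm (g \<zeta> - ?S \<zeta>)" "norm (h \<zeta> - ?S \<zeta>)"]
        by (simp add: power2_sum)
      finally show ?thesis .
    qed
    then have "(\<integral>\<^sup>+\<zeta>. ennreal ((norm (g \<zeta> - h \<zeta>))\<^sup>2) \<partial>torus I) \<le>
        (\<integral>\<^sup>+\<zeta>. 2 * ennreal ((norm (g \<zeta> - ?S \<zeta>))\<^sup>2) + 2 * ennreal ((norm (h \<zeta> - ?S \<zeta>))\<^sup>2) \<partial>torus I)"
      by (intro nn_integral_mono) (simp flip: ennreal_mult ennreal_plus ennreal_numeral)
    also have "\<dots> = 2 * (\<integral>\<^sup>+\<zeta>. ennreal ((norm (g \<zeta> - ?S \<zeta>))\<^sup>2) \<partial>torus I) +
        2 * (\<integral>\<^sup>+\<zeta>. ennreal ((norm (h \<zeta> - ?S \<zeta>))\<^sup>2) \<partial>torus I)"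
      by (simp add: nn_integral_add nn_integral_cmult)
    also have "\<dots> \<le> 2 * ennreal (e/4) + 2 * ennreal (e/4)"
      using F1 F2 by (intro add_mono mult_left_mono F1(3) F2(3)) auto
    also have "\<dots> = ennreal e"
      using that by (simp flip: ennreal_mult ennreal_plus ennreal_numeral)
    finally show ?thesis by simp
  qed
  then have "(\<integral>\<^sup>+\<zeta>. ennreal ((norm (g \<zeta> - h \<zeta>))\<^sup>2) \<partial>torus I) \<le> 0"
    by (rule ennreal_le_epsilon)
  then have "AE \<zeta> in torus I. ennreal ((norm (g \<zeta> - h \<zeta>))\<^sup>2) = 0"
    by (subst (asm) le_zero_eq, subst (asm) nn_integral_0_iff_AE) auto
  then show ?thesis by (elim eventually_mono) (simp add: ennreal_eq_0_iff)
qed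

lemma Linf_norm_leD:
  assumes "Linf_norm M f \<le> 1"
  shows "AE x in M. norm (f x) \<le> 1"
proof -
  have "AE x in M. ennreal (cmod (f x)) \<le> Linf_norm M f"
    unfolding Linf_norm_def by (rule esssup_AE)
  then show ?thesis
    by (rule eventually_mono) (use assms in \<open>auto simp flip: ennreal_le_1 intro: order_trans\<close>)
qed

lemma has_riesz_projection_riesz_projection:
  assumes "f \<in> borel_measurable (torus I)" "Linf_norm (torus I) f \<le> 1"
  shows "has_riesz_projection I f (riesz_projection I f)"
proof -
  have "(\<Sum>\<alpha>\<in>F. (norm (fourier_coeff I f \<alpha>))\<^sup>2) \<le> 1"
    if "finite F" "F \<subseteq> nonneg_multi_indices I" for F
    using bessel_inequality[OF that(1) subset_trans[OF that(2) nonneg_multi_indices_subset]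
      assms(1) Linf_norm_leD[OF assms(2)]] by simp
  note bessel = this
  have "\<exists>g. has_riesz_projection I f g"
    unfolding has_riesz_projection_iff
    by (rule riesz_fischer[OF nonneg_multi_indices_subset bessel])
       (assumption+, rule exI, intro conjI, assumption, intro allI impI, assumption)
  then show ?thesis unfolding riesz_projection_def by (rule someI_ex)
qed

text \<open>Partial sums have norm at most 1 by Bessel's inequality and come arbitrarily close to
  the projection.\<close>

lemma riesz_norm_2_le: "riesz_norm I 2 \<le> 1"
  unfolding riesz_norm_def
proof (rule SUP_least, safe)
  fix f assume f: "f \<in> borel_measurable (torus I)" "Linf_norm (torus I) f \<le> 1"
  let ?g = "riesz_projection I f" and ?c = "fourier_coeff I f"
  have g: "has_riesz_projection I f ?g"
    by (rule has_riesz_projection_riesz_projection) fact+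
  then have [measurable]: "?g \<in> borel_measurable (torus I)"
    by (simp add: has_riesz_projection_def)
  have "(\<integral>\<^sup>+\<zeta>. ennreal ((norm (?g \<zeta>))\<^sup>2) \<partial>torus I) \<le> 1 + ennreal e" if "e > 0" for e
  proof -
    \<comment> \<open>The final estimate is \<open>(1 + 1/d) d^2 + (1 + d) = 1 + 2 d + d^2\<close>.
      Since \<open>d \<le> 1\<close> and \<open>d \<le> e/3\<close>, the excess over 1 is at most
      \<open>3 d \<le> e\<close>.\<close>
    define d where "d = min 1 (e/3)"
    have d: "d > 0" "2 * d + d\<^sup>2 \<le> e"
      using \<open>e > 0\<close> mult_right_mono[of d 1 d] by (auto simp: d_def power2_eq_square)
    obtain F where F: "finite F" "F \<subseteq> nonneg_multi_indices I"
        "(\<integral>\<^sup>+\<zeta>. ennreal ((norm (?g \<zeta> - trig_sum F ?c \<zeta>))\<^sup>2) \<partial>torus I) \<le> ennreal (d\<^sup>2)"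
      by (rule has_riesz_projectionE[OF g, of "d\<^sup>2"]) (use d(1) in auto)
    let ?S = "trig_sum F ?c"
    have FI: "F \<subseteq> multi_indices I" using F nonneg_multi_indices_subset by auto
    then have [measurable]: "?S \<in> borel_measurable (torus I)"
      by (intro trig_sum_measurable)
    \<comment> \<open>The square of a sum is split with weights: the main term keeps a weight close
      to 1, at the price of the large weight \<open>1 + 1/d\<close> on the small term.\<close>
    have "(norm (?g \<zeta>))\<^sup>2 \<le> (1 + 1/d) * (norm (?g \<zeta> - ?S \<zeta>))\<^sup>2 + (1 + d) * (norm (?S \<zeta>))\<^sup>2" for \<zeta>
    proof -
      let ?a = "norm (?g \<zeta> - ?S \<zeta>)" and ?b = "norm (?S \<zeta>)"
      have "norm (?g \<zeta>) \<le> ?a + ?b" using norm_triangle_ineq[of "?g \<zeta> - ?S \<zeta>" "?S \<zeta>"] by simp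
      then have "(norm (?g \<zeta>))\<^sup>2 \<le> (?a + ?b)\<^sup>2" by (intro power_mono) auto
      also have "\<dots> = (1 + 1/d) * ?a\<^sup>2 + (1 + d) * ?b\<^sup>2 - (?a - d * ?b)\<^sup>2 / d"
        using d by (simp add: power2_eq_square field_simps)
      also have "\<dots> \<le> (1 + 1/d) * ?a\<^sup>2 + (1 + d) * ?b\<^sup>2"
        using d by simp
      finally show ?thesis .
    qed
    then have "(\<integral>\<^sup>+\<zeta>. ennreal ((norm (?g \<zeta>))\<^sup>2) \<partial>torus I) \<le>
        (\<integral>\<^sup>+\<zeta>. ennreal (1 + 1/d) * ennreal ((norm (?g \<zeta> - ?S \<zeta>))\<^sup>2) + ennreal (1 + d) * ennreal ((norm (?S \<zeta>))\<^sup>2) \<partial>torus I)"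
      using d by (intro nn_integral_mono) (simp flip: ennreal_mult ennreal_plus)
    also have "\<dots> = ennreal (1 + 1/d) * (\<integral>\<^sup>+\<zeta>. ennreal ((norm (?g \<zeta> - ?S \<zeta>))\<^sup>2) \<partial>torus I) +
        ennreal (1 + d) * (\<integral>\<^sup>+\<zeta>. ennreal ((norm (?S \<zeta>))\<^sup>2) \<partial>torus I)"
      by (simp add: nn_integral_add nn_integral_cmult)
    also have "\<dots> \<le> ennreal (1 + 1/d) * ennreal (d\<^sup>2) + ennreal (1 + d) * ennreal (1\<^sup>2)"
    proof (intro add_mono mult_left_mono F)
      show "(\<integral>\<^sup>+\<zeta>. ennreal ((norm (?S \<zeta>))\<^sup>2) \<partial>torus I) \<le> ennreal (1\<^sup>2)"
        using bessel_inequality[OF F(1) FI f(1) Linf_norm_leD[OF f(2)]]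
        by (simp only: nn_integral_norm_trig_sum[OF F(1) FI] ennreal_leI)
    qed auto
    also have "\<dots> = ennreal (1 + (2 * d + d\<^sup>2))"
      using d by (simp add: power2_eq_square field_simps flip: ennreal_mult ennreal_plus)
    also have "\<dots> \<le> ennreal (1 + e)" using d by (intro ennreal_leI) simp
    finally show ?thesis using \<open>e > 0\<close> by simp
  qed
  then have "(\<integral>\<^sup>+\<zeta>. ennreal ((norm (?g \<zeta>))\<^sup>2) \<partial>torus I) \<le> 1"
    by (rule ennreal_le_epsilon)
  then show "Lp_norm (torus I) 2 ?g \<le> 1"
    using Lp_norm_le_iff[of 2 1 "torus I" ?g] by (simp add: powr_numeral)
qed

lemma critical_exponent_ge_2: "2 \<le> critical_exponent I"
  unfolding critical_exponent_def using riesz_norm_2_le[of I]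
  by (intro Sup_upper) (auto intro!: exI[of _ 2])

subsection \<open>Trigonometric polynomials\<close>

text \<open>\<open>A\<close> confines the frequencies. Equality is asked on the space of the torus,
  where the coordinates in \<open>I\<close> have modulus 1 and the identities for products and
  conjugates of characters hold.\<close>

definition trig_poly :: "nat set \<Rightarrow> (nat \<Rightarrow> int) set \<Rightarrow> ((nat \<Rightarrow> complex) \<Rightarrow> complex) \<Rightarrow> bool" where
  "trig_poly I A f \<longleftrightarrow>
    (\<exists>F c. finite F \<and> F \<subseteq> A \<and> (\<forall>\<zeta>\<in>space (torus I). f \<zeta> = trig_sum F c \<zeta>))"

lemma trig_poly_character:
  assumes "\<alpha> \<in> A"
  shows "trig_poly I A (\<lambda>\<zeta>. c * character \<alpha> \<zeta>)"
  unfolding trig_poly_def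
  by (rule exI[of _ "{\<alpha>}"], rule exI[of _ "\<lambda>_. c"]) (use assms in \<open>auto simp: trig_sum_def\<close>)

lemma trig_poly_cong:
  assumes "\<And>\<zeta>. \<zeta> \<in> space (torus I) \<Longrightarrow> f \<zeta> = g \<zeta>"
  shows "trig_poly I A f \<longleftrightarrow> trig_poly I A g"
  using assms by (simp add: trig_poly_def)

lemma trig_poly_zero: "trig_poly I A (\<lambda>_. 0)"
  unfolding trig_poly_def by (rule exI[of _ "{}"]) (simp add: trig_sum_def)

lemma trig_poly_add:
  assumes "trig_poly I A f" "trig_poly I A g"
  shows "trig_poly I A (\<lambda>\<zeta>. f \<zeta> + g \<zeta>)"
proof -
  obtain F c where F: "finite F" "F \<subseteq> A" "\<And>\<zeta>. \<zeta> \<in> space (torus I) \<Longrightarrow> f \<zeta> = trig_sum F c \<zeta>"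
    using assms(1) unfolding trig_poly_def by auto
  obtain G d where G: "finite G" "G \<subseteq> A" "\<And>\<zeta>. \<zeta> \<in> space (torus I) \<Longrightarrow> g \<zeta> = trig_sum G d \<zeta>"
    using assms(2) unfolding trig_poly_def by auto
  let ?e = "\<lambda>\<alpha>. (if \<alpha> \<in> F then c \<alpha> else 0) + (if \<alpha> \<in> G then d \<alpha> else 0)"
  have "trig_sum F c \<zeta> + trig_sum G d \<zeta> = trig_sum (F \<union> G) ?e \<zeta>" for \<zeta>
  proof -
    have "trig_sum F c \<zeta> = (\<Sum>\<alpha>\<in>F \<union> G. if \<alpha> \<in> F then c \<alpha> * character \<alpha> \<zeta> else 0)"
      "trig_sum G d \<zeta> = (\<Sum>\<alpha>\<in>F \<union> G. if \<alpha> \<in> G then d \<alpha> * character \<alpha> \<zeta> else 0)"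
      unfolding trig_sum_def using F(1) G(1)
      by (simp_all flip: sum.inter_restrict add: Int_absorb1)
    then show ?thesis
      unfolding trig_sum_def by (auto simp flip: sum.distrib intro!: sum.cong simp: algebra_simps)
  qed
  then show ?thesis
    unfolding trig_poly_def using F G
    by (intro exI[of _ "F \<union> G"] exI[of _ ?e]) auto
qed

lemma trig_poly_sum:
  assumes "\<And>i. i \<in> S \<Longrightarrow> trig_poly I A (f i)"
  shows "trig_poly I A (\<lambda>\<zeta>. \<Sum>i\<in>S. f i \<zeta>)"
  using assms
  by (induction S rule: infinite_finite_induct) (auto intro: trig_poly_zero trig_poly_add)

text \<open>The frequencies of a product lie in the sum of the two frequency sets. Three separate
  sets allow one factor to carry a negative frequency, as in
  \<open>trig_poly_example_a_minus\<close>.\<close>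

lemma trig_poly_mult:
  assumes f: "trig_poly I A f" and g: "trig_poly I B g"
    and A: "A \<subseteq> multi_indices I" and B: "B \<subseteq> multi_indices I"
    and C: "\<And>\<alpha> \<beta>. \<alpha> \<in> A \<Longrightarrow> \<beta> \<in> B \<Longrightarrow> (\<lambda>i. \<alpha> i + \<beta> i) \<in> C"
  shows "trig_poly I C (\<lambda>\<zeta>. f \<zeta> * g \<zeta>)"
proof -
  obtain F c where F: "finite F" "F \<subseteq> A" "\<And>\<zeta>. \<zeta> \<in> space (torus I) \<Longrightarrow> f \<zeta> = trig_sum F c \<zeta>"
    using f unfolding trig_poly_def by auto
  obtain G d where G: "finite G" "G \<subseteq> B" "\<And>\<zeta>. \<zeta> \<in> space (torus I) \<Longrightarrow> g \<zeta> = trig_sum G d \<zeta>"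
    using g unfolding trig_poly_def by auto
  have eq: "f \<zeta> * g \<zeta> = (\<Sum>\<alpha>\<in>F. \<Sum>\<beta>\<in>G. (c \<alpha> * d \<beta>) * character (\<lambda>i. \<alpha> i + \<beta> i) \<zeta>)"
    if \<zeta>: "\<zeta> \<in> space (torus I)" for \<zeta>
  proof -
    have "(c \<alpha> * character \<alpha> \<zeta>) * (d \<beta> * character \<beta> \<zeta>) = (c \<alpha> * d \<beta>) * character (\<lambda>i. \<alpha> i + \<beta> i) \<zeta>"
      if "\<alpha> \<in> F" "\<beta> \<in> G" for \<alpha> \<beta>
    proof -
      have "\<alpha> \<in> multi_indices I" "\<beta> \<in> multi_indices I" using that F(2) G(2) A B by blast+
      then show ?thesis using \<zeta> by (simp add: character_add mult_ac)
    qed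
    then show ?thesis
      unfolding F(3)[OF \<zeta>] G(3)[OF \<zeta>] trig_sum_def sum_product by (auto intro!: sum.cong)
  qed
  have "trig_poly I C (\<lambda>\<zeta>. \<Sum>\<alpha>\<in>F. \<Sum>\<beta>\<in>G. (c \<alpha> * d \<beta>) * character (\<lambda>i. \<alpha> i + \<beta> i) \<zeta>)"
    using F(2) G(2) C by (intro trig_poly_sum trig_poly_character) blast
  then show ?thesis using eq by (subst trig_poly_cong) auto
qed

text \<open>Trigonometric polynomials with frequencies in such a set form an algebra. The instances
  are the nonnegative indices and those among them that vanish at one coordinate.\<close>

definition index_monoid :: "nat set \<Rightarrow> (nat \<Rightarrow> int) set \<Rightarrow> bool" where
  "index_monoid I A \<longleftrightarrow> A \<subseteq> multi_indices I \<and> (\<lambda>_. 0) \<in> A \<and>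
    (\<forall>\<alpha>\<in>A. \<forall>\<beta>\<in>A. (\<lambda>i. \<alpha> i + \<beta> i) \<in> A)"

lemma trig_poly_const: "index_monoid I A \<Longrightarrow> trig_poly I A (\<lambda>_. c)"
  using trig_poly_character[of "\<lambda>_. 0" A I c] by (simp add: index_monoid_def character_def)

lemma trig_poly_times:
  "index_monoid I A \<Longrightarrow> trig_poly I A f \<Longrightarrow> trig_poly I A g \<Longrightarrow> trig_poly I A (\<lambda>\<zeta>. f \<zeta> * g \<zeta>)"
  by (rule trig_poly_mult[where A = A and B = A]) (auto simp: index_monoid_def)

lemma trig_poly_prod:
  assumes "index_monoid I A" "\<And>i. i \<in> S \<Longrightarrow> trig_poly I A (f i)"
  shows "trig_poly I A (\<lambda>\<zeta>. \<Prod>i\<in>S. f i \<zeta>)"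
  using assms
  by (induction S rule: infinite_finite_induct) (auto intro: trig_poly_const trig_poly_times)

lemma trig_poly_minus:
  "index_monoid I A \<Longrightarrow> trig_poly I A f \<Longrightarrow> trig_poly I A (\<lambda>\<zeta>. - f \<zeta>)"
  using trig_poly_times[OF _ trig_poly_const[where c = "-1"], of I A] by fastforce

lemma character_single: "character (\<lambda>i. if i = k then m else 0) \<zeta> = \<zeta> k powi m"
  by (subst character_eq_prod[of "{k}"]) auto

lemma trig_poly_coord:
  assumes "(\<lambda>i. if i = k then int m else 0) \<in> A"
  shows "trig_poly I A (\<lambda>\<zeta>. \<zeta> k ^ m)"
  using trig_poly_character[OF assms, of I 1] by (simp add: character_single)

lemma index_monoid_nonneg: "index_monoid I (nonneg_multi_indices I)"
  using multi_indices_combine[of _ I _ "(+)"]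
  by (auto simp: index_monoid_def nonneg_multi_indices_def) (auto simp: multi_indices_def)

lemma index_monoid_nonneg_zero: "index_monoid I {\<alpha> \<in> nonneg_multi_indices I. \<alpha> j = 0}"
  using index_monoid_nonneg[of I] by (auto simp: index_monoid_def)

lemma single_nonneg: "k \<in> I \<Longrightarrow> (\<lambda>i. if i = k then int m else 0) \<in> nonneg_multi_indices I"
  by (auto simp: nonneg_multi_indices_def multi_indices_def)

text \<open>The partial sums of \<open>f\<close> over nonnegative indices equal \<open>g\<close> as
  soon as they contain the finitely many frequencies of \<open>g\<close>, because the frequencies of
  \<open>h\<close> never occur in them. The net is thus eventually constant.\<close>

lemma has_riesz_projection_trig_poly:
  assumes g: "trig_poly I (nonneg_multi_indices I) g" "g \<in> borel_measurable (torus I)"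
    and h: "trig_poly I (multi_indices I - nonneg_multi_indices I) h"
    and f: "\<And>\<zeta>. \<zeta> \<in> space (torus I) \<Longrightarrow> f \<zeta> = g \<zeta> + h \<zeta>"
  shows "has_riesz_projection I f g"
proof -
  obtain G c where G: "finite G" "G \<subseteq> nonneg_multi_indices I"
      "\<And>\<zeta>. \<zeta> \<in> space (torus I) \<Longrightarrow> g \<zeta> = trig_sum G c \<zeta>"
    using g(1) unfolding trig_poly_def by auto
  obtain H d where H: "finite H" "H \<subseteq> multi_indices I - nonneg_multi_indices I"
      "\<And>\<zeta>. \<zeta> \<in> space (torus I) \<Longrightarrow> h \<zeta> = trig_sum H d \<zeta>"
    using h unfolding trig_poly_def by auto
  have disj: "G \<inter> H = {}" using G(2) H(2) by auto
  let ?e = "\<lambda>\<alpha>. if \<alpha> \<in> G then c \<alpha> else d \<alpha>"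
  have GH: "finite (G \<union> H)" "G \<union> H \<subseteq> multi_indices I"
    using G(1,2) H(1,2) nonneg_multi_indices_subset[of I] by auto
  have "f \<zeta> = trig_sum (G \<union> H) ?e \<zeta>" if "\<zeta> \<in> space (torus I)" for \<zeta>
    unfolding f[OF that] G(3)[OF that] H(3)[OF that] trig_sum_def
    using G(1) H(1) disj by (subst sum.union_disjoint) (auto intro!: sum.cong arg_cong2[where f = "(+)"])
  then have "fourier_coeff I f \<beta> = fourier_coeff I (trig_sum (G \<union> H) ?e) \<beta>" for \<beta>
    unfolding fourier_coeff_def by (intro Bochner_Integration.integral_cong) auto
  then have coeff: "fourier_coeff I f \<beta> = (if \<beta> \<in> G \<union> H then ?e \<beta> else 0)"
    if "\<beta> \<in> multi_indices I" for \<beta>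
    using fourier_coeff_trig_sum[OF GH that] by simp
  have "trig_sum F (fourier_coeff I f) \<zeta> = trig_sum G c \<zeta>"
    if F: "finite F" "G \<subseteq> F" "F \<subseteq> nonneg_multi_indices I" for F \<zeta>
  proof -
    have *: "fourier_coeff I f \<beta> = (if \<beta> \<in> G then c \<beta> else 0)" if "\<beta> \<in> F" for \<beta>
    proof -
      have "\<beta> \<in> multi_indices I" "\<beta> \<notin> H"
        using that F(3) H(2) nonneg_multi_indices_subset[of I] by auto
      then show ?thesis using coeff[of \<beta>] by simp
    qed
    then show ?thesis
      unfolding trig_sum_def using F(1,2)
      by (intro sum.mono_neutral_cong_right) auto
  qed
  then have "(\<integral>\<^sup>+\<zeta>. ennreal ((norm (g \<zeta> - trig_sum F (fourier_coeff I f) \<zeta>))\<^sup>2) \<partial>torus I) = 0"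
    if F: "finite F" "G \<subseteq> F" "F \<subseteq> nonneg_multi_indices I" for F
    using F by (subst nn_integral_cong[where v = "\<lambda>_. 0"]) (simp_all add: G(3))
  then show ?thesis
    unfolding has_riesz_projection_iff using g(2) G(1,2)
    by (intro conjI allI impI exI[of _ G]) auto
qed

section \<open>Products of functions of single coordinates, and inequalities for powers\<close>

lemma torus_integral_prod:
  fixes \<phi> :: "nat \<Rightarrow> complex \<Rightarrow> real"
  assumes "finite S" "S \<subseteq> I"
    and meas: "\<And>i. i \<in> S \<Longrightarrow> \<phi> i \<in> borel_measurable circle_measure"
    and bdd: "\<And>i z. i \<in> S \<Longrightarrow> norm z = 1 \<Longrightarrow> \<bar>\<phi> i z\<bar> \<le> 1"
  shows "(LINT \<zeta>|torus I. (\<Prod>i\<in>S. \<phi> i (\<zeta> i))) = (\<Prod>i\<in>S. LINT z|circle_measure. \<phi> i z)"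
  using assms
proof (induction S rule: finite_induct)
  case empty
  then show ?case by (simp add: torus.prob_space)
next
  case (insert k S)
  have "(LINT \<zeta>|torus I. \<phi> k (\<zeta> k) * (\<Prod>i\<in>S. \<phi> i (\<zeta> i))) =
      (LINT z|circle_measure. \<phi> k z) * (LINT \<zeta>|torus I. (\<Prod>i\<in>S. \<phi> i (\<zeta> i)))"
  proof (rule torus_integral_mult[where B = 1 and C = 1])
    show "(\<lambda>\<zeta>. \<Prod>i\<in>S. \<phi> i (\<zeta> i)) \<in> borel_measurable (torus I)"
      using insert.prems by (intro borel_measurable_prod measurable_torus_coord) auto
    show "norm (\<Prod>i\<in>S. \<phi> i (\<zeta> i)) \<le> 1" if "\<zeta> \<in> space (torus I)" for \<zeta>
      unfolding prod_norm[symmetric]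
    proof (intro prod_le_1 conjI)
      fix i assume "i \<in> S"
      then show "norm (\<phi> i (\<zeta> i)) \<le> 1"
        using insert.prems(3)[of i "\<zeta> i"] insert.prems(1) space_torusD[OF that, of i] by auto
    qed simp
    show "(\<Prod>i\<in>S. \<phi> i ((\<zeta>(k := x)) i)) = (\<Prod>i\<in>S. \<phi> i (\<zeta> i))" for \<zeta> x
      using insert.hyps by (intro prod.cong) auto
  qed (use insert.prems in auto)
  then show ?case using insert by simp
qed

text \<open>The left side is the tangent of \<open>y^r\<close> at \<open>x\<close>. It comes from
  Young's inequality with the exponents \<open>r\<close> and \<open>r / (r - 1)\<close>, which
  includes the case \<open>x = 0\<close>.\<close>

lemma powr_tangent:
  fixes x y r :: real
  assumes "x \<ge> 0" "y \<ge> 0" "r > 1"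
  shows "r * x powr (r - 1) * y - (r - 1) * x powr r \<le> y powr r"
proof -
  have "y * x powr (r - 1) \<le> y powr r / r + (x powr (r - 1)) powr (r / (r - 1)) / (r / (r - 1))"
    using assms by (intro Youngs_inequality) (auto simp: field_simps)
  also have "(x powr (r - 1)) powr (r / (r - 1)) = x powr r"
    using assms by (simp add: powr_powr)
  finally have "y * x powr (r - 1) * r \<le> (y powr r / r + x powr r / (r / (r - 1))) * r"
    using assms by (intro mult_right_mono) auto
  also have "\<dots> = y powr r + (r - 1) * x powr r"
    using assms by (simp add: field_simps)
  finally show ?thesis by (simp add: algebra_simps)
qed

text \<open>Each summand \<open>t\<close> satisfies \<open>t^r \<le> t (x + y)^(r - 1)\<close>, and
  the two bounds add up to \<open>(x + y)^r\<close>.\<close>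

lemma powr_superadditive:
  fixes x y r :: real
  assumes "x \<ge> 0" "y \<ge> 0" "r \<ge> 1"
  shows "x powr r + y powr r \<le> (x + y) powr r"
proof -
  have *: "a powr r \<le> a * (x + y) powr (r - 1)" if "0 \<le> a" "a \<le> x + y" for a
  proof (cases "a = 0")
    case False
    then have "a powr r = a * a powr (r - 1)" using that by (simp add: powr_diff)
    also have "\<dots> \<le> a * (x + y) powr (r - 1)"
      using that assms by (intro mult_left_mono powr_mono2) auto
    finally show ?thesis .
  qed simp
  have "x powr r + y powr r \<le> (x + y) * (x + y) powr (r - 1)"
    using *[of x] *[of y] assms by (simp add: distrib_right)
  also have "\<dots> = (x + y) powr r"
    using assms by (cases "x + y = 0") (simp_all add: powr_diff)
  finally show ?thesis .
qed

text \<open>Bernoulli's inequality, as the tangent at 1. It serves to bound the loss caused by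
  \<open>one_head\<close> and to compare moments of different order.\<close>

lemma powr_ge_linear:
  fixes t r :: real
  assumes "t \<ge> 0" "r > 1"
  shows "1 + r * (t - 1) \<le> t powr r"
  using powr_tangent[of 1 t r] assms by (simp add: algebra_simps)

text \<open>
  The expectation over the coordinates in \<open>K\<close> is estimated with the tangent of \<open>y\<^sup>r\<close> at
  \<open>y = \<Sum>l\<in>K. \<bar>u\<^sub>l\<bar>\<^sup>2\<close>; the cross terms of \<open>\<bar>\<Sum>l\<in>K. \<zeta>\<^sub>l u\<^sub>l\<bar>\<^sup>2\<close> integrate to \<open>0\<close>.
\<close>

lemma torus_integral_randomized_sum:
  fixes u :: "nat \<Rightarrow> (nat \<Rightarrow> complex) \<Rightarrow> complex"
  assumes K: "finite K" "K \<subseteq> I" and r: "r > 1"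
    and meas: "\<And>l. l \<in> K \<Longrightarrow> u l \<in> borel_measurable (torus I)"
    and bdd: "\<And>l \<zeta>. l \<in> K \<Longrightarrow> \<zeta> \<in> space (torus I) \<Longrightarrow> norm (u l \<zeta>) \<le> C"
    and indep: "\<And>l k \<zeta> x. l \<in> K \<Longrightarrow> k \<in> K \<Longrightarrow> u l (\<zeta>(k := x)) = u l \<zeta>"
  shows "(LINT \<zeta>|torus I. (\<Sum>l\<in>K. (norm (u l \<zeta>))\<^sup>2) powr r) \<le>
    (LINT \<zeta>|torus I. norm (\<Sum>l\<in>K. \<zeta> l * u l \<zeta>) powr (2 * r))"
proof -
  define X where "X \<zeta> = (\<Sum>l\<in>K. (norm (u l \<zeta>))\<^sup>2)" for \<zeta>
  \<comment> \<open>\<open>r Y\<close> is the slope of the tangent of \<open>y^r\<close> at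
    \<open>X\<close>, so \<open>Y\<close> is the weight with which \<open>|G|^2\<close> gets
    integrated.\<close>
  define Y where "Y \<zeta> = X \<zeta> powr (r - 1)" for \<zeta>
  define G where "G \<zeta> = (\<Sum>l\<in>K. \<zeta> l * u l \<zeta>)" for \<zeta>
  let ?B = "real (card K) * C\<^sup>2"
  have coord: "(\<lambda>\<zeta>. \<zeta> l) \<in> borel_measurable (torus I)" if "l \<in> K" for l
    using measurable_torus_coord[of l I "\<lambda>z. z"] that K
    by (auto intro!: measurable_circle_borel continuous_intros)
  note [measurable] = coord meas
  have [measurable]: "X \<in> borel_measurable (torus I)" "G \<in> borel_measurable (torus I)"
    unfolding X_def G_def by measurable
  have [measurable]: "Y \<in> borel_measurable (torus I)"
    unfolding Y_def by measurable
  have X_nonneg: "X \<zeta> \<ge> 0" for \<zeta> by (auto simp: X_def intro: sum_nonneg)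
  have X_le: "X \<zeta> \<le> ?B" if "\<zeta> \<in> space (torus I)" for \<zeta>
    unfolding X_def using that bdd by (intro sum_bounded_above power_mono) auto
  have Y_le: "\<bar>Y \<zeta>\<bar> \<le> ?B powr (r - 1)" if "\<zeta> \<in> space (torus I)" for \<zeta>
    unfolding Y_def using X_le[OF that] X_nonneg r by (simp add: powr_mono2)
  have norm_term: "norm (\<zeta> l * u l \<zeta>) = norm (u l \<zeta>)" if "\<zeta> \<in> space (torus I)" "l \<in> K" for \<zeta> l
    using that K by (simp add: norm_mult space_torusD subset_iff)
  have G_le: "norm (G \<zeta>) \<le> real (card K) * C" if "\<zeta> \<in> space (torus I)" for \<zeta>
    unfolding G_def using that bdd norm_term by (intro sum_norm_bound) auto
  let ?T = "\<lambda>l m \<zeta>. of_real (Y \<zeta>) * (\<zeta> l * u l \<zeta>) * cnj (\<zeta> m * u m \<zeta>)"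
  have int_T: "integrable (torus I) (?T l m)" if "l \<in> K" "m \<in> K" for l m
  proof (rule integrable_bounded_torus[where B = "?B powr (r - 1) * C * C"])
    fix \<zeta> assume \<zeta>: "\<zeta> \<in> space (torus I)"
    have "norm (?T l m \<zeta>) = \<bar>Y \<zeta>\<bar> * norm (\<zeta> l * u l \<zeta>) * norm (\<zeta> m * u m \<zeta>)"
      by (simp add: norm_mult)
    also have "\<dots> = \<bar>Y \<zeta>\<bar> * norm (u l \<zeta>) * norm (u m \<zeta>)"
      using norm_term[OF \<zeta>] that by simp
    also have "\<dots> \<le> ?B powr (r - 1) * C * C"
      using Y_le[OF \<zeta>] bdd[OF _ \<zeta>] that by (intro mult_mono') auto
    finally show "norm (?T l m \<zeta>) \<le> ?B powr (r - 1) * C * C" .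
  qed (use that in measurable)
  \<comment> \<open>The coordinate \<open>\<zeta> l\<close> occurs only as one linear factor:
    \<open>u\<close>, and with it \<open>X\<close> and \<open>Y\<close>, ignores the coordinates in
    \<open>K\<close>, and \<open>m\<close> differs from \<open>l\<close>. Its mean is 0.\<close>
  have off: "(LINT \<zeta>|torus I. ?T l m \<zeta>) = 0" if lm: "l \<in> K" "m \<in> K" "l \<noteq> m" for l m
  proof -
    let ?\<psi> = "\<lambda>\<zeta>. of_real (Y \<zeta>) * u l \<zeta> * cnj (\<zeta> m * u m \<zeta>)"
    have "(LINT \<zeta>|torus I. (\<zeta> l) powi 1 * ?\<psi> \<zeta>) =
        (LINT z|circle_measure. z powi 1) * (LINT \<zeta>|torus I. ?\<psi> \<zeta>)"
    proof (rule torus_integral_mult[where \<phi> = "\<lambda>z. z powi 1" and B = 1 and C = "?B powr (r - 1) * C * C"])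
      show "?\<psi> \<in> borel_measurable (torus I)" using lm by measurable
      fix \<zeta> assume \<zeta>: "\<zeta> \<in> space (torus I)"
      have "norm (?\<psi> \<zeta>) = \<bar>Y \<zeta>\<bar> * norm (u l \<zeta>) * norm (u m \<zeta>)"
        using norm_term[OF \<zeta>] lm by (simp add: norm_mult)
      also have "\<dots> \<le> ?B powr (r - 1) * C * C"
        using Y_le[OF \<zeta>] bdd[OF _ \<zeta>] lm by (intro mult_mono') auto
      finally show "norm (?\<psi> \<zeta>) \<le> ?B powr (r - 1) * C * C" .
    next
      fix \<zeta> x
      have "X (\<zeta>(l := x)) = X \<zeta>"
        unfolding X_def by (intro sum.cong) (simp_all add: indep lm del: fun_upd_apply)
      then show "?\<psi> (\<zeta>(l := x)) = ?\<psi> \<zeta>"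
        using lm by (simp add: Y_def indep[OF _ lm(1)] del: fun_upd_apply) simp
    qed (use lm K in \<open>auto intro!: measurable_circle_borel continuous_intros\<close>)
    then show ?thesis using circle_integral_powi[of 1] by (simp add: mult_ac)
  qed
  have "of_real (LINT \<zeta>|torus I. Y \<zeta> * (norm (G \<zeta>))\<^sup>2) = (LINT \<zeta>|torus I. (\<Sum>l\<in>K. \<Sum>m\<in>K. ?T l m \<zeta>))"
    unfolding integral_complex_of_real[symmetric]
  proof (rule Bochner_Integration.integral_cong[OF refl])
    fix \<zeta>
    have "complex_of_real (Y \<zeta> * (norm (G \<zeta>))\<^sup>2) = of_real (Y \<zeta>) * (G \<zeta> * cnj (G \<zeta>))"
      by (simp only: of_real_mult complex_norm_square)
    also have "\<dots> = (\<Sum>l\<in>K. \<Sum>m\<in>K. ?T l m \<zeta>)"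
      unfolding G_def cnj_sum sum_product by (simp only: sum_distrib_left mult.assoc)
    finally show "complex_of_real (Y \<zeta> * (norm (G \<zeta>))\<^sup>2) = (\<Sum>l\<in>K. \<Sum>m\<in>K. ?T l m \<zeta>)" .
  qed
  also have "\<dots> = (\<Sum>l\<in>K. \<Sum>m\<in>K. LINT \<zeta>|torus I. ?T l m \<zeta>)"
    using int_T by (subst Bochner_Integration.integral_sum; intro Bochner_Integration.integrable_sum sum.cong refl)
      (simp_all add: Bochner_Integration.integral_sum)
  also have "\<dots> = (\<Sum>l\<in>K. LINT \<zeta>|torus I. ?T l l \<zeta>)"
  proof (rule sum.cong[OF refl])
    fix l assume l: "l \<in> K"
    have "(\<Sum>m\<in>K. LINT \<zeta>|torus I. ?T l m \<zeta>) = (\<Sum>m\<in>{l}. LINT \<zeta>|torus I. ?T l m \<zeta>)"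
      using l K off by (intro sum.mono_neutral_right) auto
    then show "(\<Sum>m\<in>K. LINT \<zeta>|torus I. ?T l m \<zeta>) = (LINT \<zeta>|torus I. ?T l l \<zeta>)" by simp
  qed
  also have "\<dots> = (LINT \<zeta>|torus I. (\<Sum>l\<in>K. ?T l l \<zeta>))"
    using int_T by (subst Bochner_Integration.integral_sum) auto
  also have "\<dots> = (LINT \<zeta>|torus I. complex_of_real (Y \<zeta> * X \<zeta>))"
  proof (rule Bochner_Integration.integral_cong[OF refl])
    fix \<zeta> assume \<zeta>: "\<zeta> \<in> space (torus I)"
    have "?T l l \<zeta> = of_real (Y \<zeta> * (norm (u l \<zeta>))\<^sup>2)" if "l \<in> K" for l
      unfolding mult.assoc complex_norm_square[symmetric] norm_term[OF \<zeta> that] by simp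
    then show "(\<Sum>l\<in>K. ?T l l \<zeta>) = complex_of_real (Y \<zeta> * X \<zeta>)"
      unfolding X_def sum_distrib_left of_real_sum by (rule sum.cong[OF refl])
  qed
  finally have YG: "(LINT \<zeta>|torus I. Y \<zeta> * (norm (G \<zeta>))\<^sup>2) = (LINT \<zeta>|torus I. Y \<zeta> * X \<zeta>)"
    by (simp only: integral_complex_of_real of_real_eq_iff)
  have YX: "Y \<zeta> * X \<zeta> = X \<zeta> powr r" for \<zeta>
    using X_nonneg[of \<zeta>] r by (cases "X \<zeta> = 0") (simp_all add: Y_def powr_diff)
  have int1: "integrable (torus I) (\<lambda>\<zeta>. Y \<zeta> * (norm (G \<zeta>))\<^sup>2)"
  proof (rule integrable_bounded_torus[where B = "?B powr (r - 1) * (real (card K) * C)\<^sup>2"])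
    fix \<zeta> assume \<zeta>: "\<zeta> \<in> space (torus I)"
    then show "norm (Y \<zeta> * (norm (G \<zeta>))\<^sup>2) \<le> ?B powr (r - 1) * (real (card K) * C)\<^sup>2"
      using Y_le[OF \<zeta>] G_le[OF \<zeta>] unfolding real_norm_def abs_mult
      by (intro mult_mono') (auto intro: power_mono)
  qed measurable
  have int2: "integrable (torus I) (\<lambda>\<zeta>. X \<zeta> powr r)"
    by (rule integrable_bounded_torus[where B = "?B powr r"])
       (use X_le X_nonneg r in \<open>auto intro: powr_mono2\<close>)
  have int3: "integrable (torus I) (\<lambda>\<zeta>. norm (G \<zeta>) powr (2 * r))"
    by (rule integrable_bounded_torus[where B = "(real (card K) * C) powr (2 * r)"])
       (use G_le r in \<open>auto intro: powr_mono2\<close>)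
  \<comment> \<open>\<open>Y |G|^2\<close> has the same integral as \<open>Y X = X^r\<close>, so the
    tangent integrates to \<open>r - (r - 1) = 1\<close> times the integral of
    \<open>X^r\<close>.\<close>
  have "(LINT \<zeta>|torus I. X \<zeta> powr r) =
      (LINT \<zeta>|torus I. r * (Y \<zeta> * (norm (G \<zeta>))\<^sup>2) - (r - 1) * X \<zeta> powr r)"
    using int1 int2 YG[unfolded YX] by (simp add: left_diff_distrib)
  also have "\<dots> \<le> (LINT \<zeta>|torus I. norm (G \<zeta>) powr (2 * r))"
  proof (rule integral_mono)
    fix \<zeta>
    have "((norm (G \<zeta>))\<^sup>2) powr r = norm (G \<zeta>) powr (2 * r)"
      by (simp add: powr_powr flip: powr_numeral)
    then show "r * (Y \<zeta> * (norm (G \<zeta>))\<^sup>2) - (r - 1) * X \<zeta> powr r \<le> norm (G \<zeta>) powr (2 * r)"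
      using powr_tangent[OF X_nonneg[of \<zeta>] zero_le_power2[of "norm (G \<zeta>)"] r]
      by (simp add: Y_def mult.assoc)
  qed (use int1 int2 int3 in auto)
  finally show ?thesis by (simp add: X_def G_def)
qed

subsection \<open>The Kakeya-type example\<close>

text \<open>The approximating functions are polynomials in \<open>Re z\<close>, so only cosines
  occur. One real coefficient sequence then describes the polynomial together with its analytic part
  \<open>a_plus\<close>.\<close>

definition cos_poly :: "(complex \<Rightarrow> real) \<Rightarrow> bool" where
  "cos_poly u \<longleftrightarrow>
    (\<exists>F c. finite F \<and> (\<forall>z. norm z = 1 \<longrightarrow> u z = (\<Sum>k\<in>F. c k * Re (z ^ k))))"

lemma cos_poly_cong: "(\<And>z. norm z = 1 \<Longrightarrow> u z = v z) \<Longrightarrow> cos_poly u \<longleftrightarrow> cos_poly v"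
  by (simp add: cos_poly_def)

lemma cos_poly_monom: "cos_poly (\<lambda>z. a * Re (z ^ k))"
  unfolding cos_poly_def by (rule exI[of _ "{k}"], rule exI[of _ "\<lambda>_. a"]) simp

lemma cos_poly_const: "cos_poly (\<lambda>_. a)"
  using cos_poly_monom[of a 0] by simp

lemma cos_poly_Re: "cos_poly Re"
  using cos_poly_monom[of 1 1] by simp

lemma cos_poly_add:
  assumes "cos_poly u" "cos_poly v"
  shows "cos_poly (\<lambda>z. u z + v z)"
proof -
  obtain F c where F: "finite F" "\<And>z. norm z = 1 \<Longrightarrow> u z = (\<Sum>k\<in>F. c k * Re (z ^ k))"
    using assms(1) unfolding cos_poly_def by auto
  obtain G d where G: "finite G" "\<And>z. norm z = 1 \<Longrightarrow> v z = (\<Sum>k\<in>G. d k * Re (z ^ k))"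
    using assms(2) unfolding cos_poly_def by auto
  let ?e = "\<lambda>k. (if k \<in> F then c k else 0) + (if k \<in> G then d k else 0)"
  have "u z + v z = (\<Sum>k\<in>F \<union> G. ?e k * Re (z ^ k))" if "norm z = 1" for z
  proof -
    have "(\<Sum>k\<in>F. c k * Re (z ^ k)) = (\<Sum>k\<in>F \<union> G. if k \<in> F then c k * Re (z ^ k) else 0)"
      "(\<Sum>k\<in>G. d k * Re (z ^ k)) = (\<Sum>k\<in>F \<union> G. if k \<in> G then d k * Re (z ^ k) else 0)"
      using F(1) G(1) by (simp_all flip: sum.inter_restrict add: Int_absorb1)
    then show ?thesis
      unfolding F(2)[OF that] G(2)[OF that]
      by (auto simp flip: sum.distrib intro!: sum.cong simp: algebra_simps)
  qed
  then show ?thesis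
    unfolding cos_poly_def using F(1) G(1) by (intro exI[of _ "F \<union> G"] exI[of _ ?e]) auto
qed

lemma cos_poly_sum:
  assumes "\<And>i. i \<in> S \<Longrightarrow> cos_poly (u i)"
  shows "cos_poly (\<lambda>z. \<Sum>i\<in>S. u i z)"
  using assms
  by (induction S rule: infinite_finite_induct) (auto intro: cos_poly_const cos_poly_add)

text \<open>A product-to-sum formula for cosines: \<open>v = z^(j - k)\<close> and
  \<open>w = z^k\<close> yield the frequencies \<open>j + k\<close> and
  \<open>j - k\<close>.\<close>

lemma Re_mult_Re_circle:
  assumes "norm w = 1"
  shows "Re (v * w) * Re w = (Re (v * w * w) + Re v) / 2"
proof -
  have "(Re w)\<^sup>2 + (Im w)\<^sup>2 = 1" using assms cmod_power2[of w] by simp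
  then have "Im w * Im w = 1 - Re w * Re w" by (simp add: power2_eq_square)
  then show ?thesis by (simp add: algebra_simps) algebra
qed

lemma cos_poly_mult:
  assumes "cos_poly u" "cos_poly v"
  shows "cos_poly (\<lambda>z. u z * v z)"
proof -
  obtain F c where F: "finite F" "\<And>z. norm z = 1 \<Longrightarrow> u z = (\<Sum>k\<in>F. c k * Re (z ^ k))"
    using assms(1) unfolding cos_poly_def by auto
  obtain G d where G: "finite G" "\<And>z. norm z = 1 \<Longrightarrow> v z = (\<Sum>k\<in>G. d k * Re (z ^ k))"
    using assms(2) unfolding cos_poly_def by auto
  \<comment> \<open>\<open>max j k - min j k\<close> is the absolute difference of \<open>j\<close>
    and \<open>k\<close>, where plain subtraction of natural numbers would truncate.\<close>
  let ?w = "\<lambda>z. \<Sum>j\<in>F. \<Sum>k\<in>G. (c j * d k / 2) * Re (z ^ (j + k)) +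
      (c j * d k / 2) * Re (z ^ (max j k - min j k))"
  have Re2: "Re (z ^ j) * Re (z ^ k) = (Re (z ^ (j + k)) + Re (z ^ (j - k))) / 2"
    if "norm z = 1" "k \<le> j" for z j k
    using Re_mult_Re_circle[of "z ^ k" "z ^ (j - k)"] that
    by (simp add: norm_power flip: power_add)
  have "Re (z ^ j) * Re (z ^ k) = (Re (z ^ (j + k)) + Re (z ^ (max j k - min j k))) / 2"
    if "norm z = 1" for z j k
    using Re2[OF that, of j k] Re2[OF that, of k j]
    by (cases "j \<le> k") (simp_all add: max_def min_def mult.commute add.commute)
  then have "c j * Re (z ^ j) * (d k * Re (z ^ k)) = (c j * d k / 2) * Re (z ^ (j + k)) +
      (c j * d k / 2) * Re (z ^ (max j k - min j k))" if "norm z = 1" for z j k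
    using that by (simp add: field_simps)
  then have eq: "u z * v z = ?w z" if "norm z = 1" for z
    unfolding F(2)[OF that] G(2)[OF that] sum_product using that by (intro sum.cong refl)
  have "cos_poly ?w"
    by (intro cos_poly_sum cos_poly_add cos_poly_monom)
  then show ?thesis using cos_poly_cong[of "\<lambda>z. u z * v z" ?w, OF eq] by simp
qed

lemma cos_poly_diff: "cos_poly u \<Longrightarrow> cos_poly v \<Longrightarrow> cos_poly (\<lambda>z. u z - v z)"
  using cos_poly_add[OF _ cos_poly_mult[OF cos_poly_const[of "-1"]], of u v] by simp

lemma cos_poly_power: "cos_poly u \<Longrightarrow> cos_poly (\<lambda>z. u z ^ k)"
  by (induction k) (auto intro: cos_poly_const[of 1, simplified] cos_poly_mult)

lemma cos_polyE:
  assumes "cos_poly u"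
  obtains D c where "\<And>z. norm z = 1 \<Longrightarrow> u z = (\<Sum>k\<le>D. c k * Re (z ^ k))"
proof -
  obtain F c where F: "finite F" "\<And>z. norm z = 1 \<Longrightarrow> u z = (\<Sum>k\<in>F. c k * Re (z ^ k))"
    using assms unfolding cos_poly_def by auto
  obtain D where "F \<subseteq> {..D}" using F(1) finite_nat_iff_bounded_le by auto
  then have "(\<Sum>k\<in>F. c k * Re (z ^ k)) = (\<Sum>k\<le>D. (if k \<in> F then c k else 0) * Re (z ^ k))" for z
    by (intro sum.mono_neutral_cong_left) auto
  then show thesis using that[where D = D and c = "\<lambda>k. if k \<in> F then c k else 0"] F(2) by simp
qed

text \<open>If the \<open>a i\<close> are probabilities of independent events, the left side is the
  probability that at most one of them occurs. In the induction the term without any event and the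
  term where only \<open>k\<close> occurs recombine to the product over \<open>S\<close>.\<close>

lemma sum_mult_prod_le_1:
  fixes a :: "'a \<Rightarrow> real"
  assumes "finite S" "\<And>i. i \<in> S \<Longrightarrow> 0 \<le> a i" "\<And>i. i \<in> S \<Longrightarrow> a i \<le> 1"
  shows "(\<Prod>i\<in>S. 1 - a i) + (\<Sum>j\<in>S. a j * (\<Prod>i\<in>S - {j}. 1 - a i)) \<le> 1"
  using assms
proof (induction S rule: finite_induct)
  case (insert k S)
  have "(\<Sum>j\<in>S. a j * (\<Prod>i\<in>insert k S - {j}. 1 - a i)) =
      (\<Sum>j\<in>S. (1 - a k) * (a j * (\<Prod>i\<in>S - {j}. 1 - a i)))"
  proof (rule sum.cong[OF refl])
    fix j assume "j \<in> S"
    then have "insert k S - {j} = insert k (S - {j})" using insert.hyps by auto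
    then show "a j * (\<Prod>i\<in>insert k S - {j}. 1 - a i) = (1 - a k) * (a j * (\<Prod>i\<in>S - {j}. 1 - a i))"
      using insert.hyps by simp
  qed
  moreover have "insert k S - {k} = S" using insert.hyps by auto
  ultimately have "(\<Prod>i\<in>insert k S. 1 - a i) + (\<Sum>j\<in>insert k S. a j * (\<Prod>i\<in>insert k S - {j}. 1 - a i)) =
      (\<Prod>i\<in>S. 1 - a i) + (1 - a k) * (\<Sum>j\<in>S. a j * (\<Prod>i\<in>S - {j}. 1 - a i))"
    using insert.hyps by (simp add: algebra_simps sum_distrib_left)
  also have "\<dots> \<le> (\<Prod>i\<in>S. 1 - a i) + 1 * (\<Sum>j\<in>S. a j * (\<Prod>i\<in>S - {j}. 1 - a i))"
    using insert.prems by (intro add_left_mono mult_right_mono sum_nonneg mult_nonneg_nonneg prod_nonneg) auto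
  also have "\<dots> \<le> 1" using insert by simp
  finally show ?case .
qed simp

text \<open>
  The function \<open>a\<close> approximates the indicator of heads. The coordinates \<open>Suc (n + j)\<close> with \<open>j < n\<close> are
  the coins \<open>z\<^sub>j\<close>, the coordinates \<open>l \<le> n\<close> are the signs, and \<open>\<zeta> n\<close> is the sign \<open>w\<^sub>0\<close> of the
  event that there is not exactly one head.
\<close>

locale kakeya_example =
  fixes I :: "nat set" and n D :: nat and c :: "nat \<Rightarrow> real" and a :: "complex \<Rightarrow> real"
  assumes I: "{..2 * n} \<subseteq> I"
    and a_eq: "\<And>z. norm z = 1 \<Longrightarrow> a z = (\<Sum>k\<le>D. c k * Re (z ^ k))"
    and a_nonneg: "\<And>z. norm z = 1 \<Longrightarrow> 0 \<le> a z"
    and a_le_1: "\<And>z. norm z = 1 \<Longrightarrow> a z \<le> 1"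
begin

text \<open>\<open>a_plus\<close> is the Riesz projection of \<open>a\<close> in one variable, read
  off from \<open>Re (z^k) = (z^k + z^(-k)) / 2\<close> on the circle; \<open>a_minus\<close> is the
  part that the projection discards.\<close>

definition a_plus :: "complex \<Rightarrow> complex" where
  "a_plus z = of_real (c 0) + (\<Sum>k=1..D. of_real (c k / 2) * z ^ k)"

definition a_minus :: "complex \<Rightarrow> complex" where
  "a_minus z = (\<Sum>k=1..D. of_real (c k / 2) * z powi (- int k))"

lemma powi_minus_circle:
  assumes "norm (z::complex) = 1"
  shows "z powi (- int k) = cnj (z ^ k)"
proof -
  have "z ^ k * cnj (z ^ k) = 1"
    using assms by (simp only: complex_norm_square[symmetric] norm_power) simp
  then show ?thesis
    by (simp add: power_int_minus inverse_unique)
qed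

lemma a_split_0: "norm z = 1 \<Longrightarrow> a z = c 0 + (\<Sum>k=1..D. c k * Re (z ^ k))"
  by (simp add: a_eq atMost_atLeast0 sum.atLeast_Suc_atMost)

lemma a_eq_plus_minus:
  assumes "norm z = 1"
  shows "of_real (a z) = a_plus z + a_minus z"
proof -
  have "of_real (c k * Re (z ^ k)) = of_real (c k / 2) * z ^ k + of_real (c k / 2) * z powi (- int k)" for k
    unfolding powi_minus_circle[OF assms] distrib_left[symmetric] complex_add_cnj by simp
  then show ?thesis
    by (simp only: a_split_0[OF assms] a_plus_def a_minus_def of_real_add of_real_sum sum.distrib add.assoc)
qed

text \<open>The real part averages \<open>a\<close> with its mean \<open>c 0\<close>. Hence
  \<open>|a_plus| \<ge> c 0 / 2\<close> even where \<open>a\<close> vanishes, which is the source of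
  the gain on the event without heads.\<close>

lemma Re_a_plus:
  assumes "norm z = 1"
  shows "Re (a_plus z) = (c 0 + a z) / 2"
  unfolding a_split_0[OF assms] a_plus_def
  by (simp add: sum_divide_distrib[symmetric] field_simps)

lemma norm_a_plus_le:
  assumes "norm z = 1"
  shows "norm (a_plus z) \<le> \<bar>c 0\<bar> + (\<Sum>k=1..D. \<bar>c k / 2\<bar>)"
  unfolding a_plus_def
  by (rule norm_triangle_mono) (use assms in \<open>auto intro!: sum_norm_le simp: norm_mult norm_power\<close>)

lemma a_measurable: "a \<in> borel_measurable circle_measure"
proof -
  have "(\<lambda>z. \<Sum>k\<le>D. c k * Re (z ^ k)) \<in> borel_measurable circle_measure"
    by (intro measurable_circle_borel continuous_intros)
  then show ?thesis by (rule measurable_cong[THEN iffD1, rotated]) (simp add: a_eq)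
qed

text \<open>The nonconstant cosines have mean 0, so \<open>c 0\<close> acts as the probability of
  heads.\<close>

lemma integral_a: "(LINT z|circle_measure. a z) = c 0"
proof -
  have int: "integrable circle_measure (\<lambda>z::complex. z ^ k)" for k
    by (rule circle.integrable_const_bound[where B = 1])
       (auto intro!: measurable_circle_borel continuous_intros simp: norm_power)
  have zero: "(LINT z|circle_measure. Re (z ^ k)) = 0" if "k \<ge> 1" for k
    using circle_integral_powi[of "int k"] that int[of k] by (simp add: integral_Re)
  have "(LINT z|circle_measure. a z) = (LINT z|circle_measure. c 0 + (\<Sum>k=1..D. c k * Re (z ^ k)))"
    by (rule Bochner_Integration.integral_cong) (simp_all add: a_split_0)
  also have "\<dots> = c 0 + (\<Sum>k=1..D. c k * (LINT z|circle_measure. Re (z ^ k)))"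
    using int by (subst Bochner_Integration.integral_add)
      (auto intro!: sum.cong simp: Bochner_Integration.integral_sum circle.prob_space[simplified])
  also have "\<dots> = c 0" by (simp add: zero)
  finally show ?thesis .
qed

lemma a_integrable: "integrable circle_measure a"
  by (rule circle.integrable_const_bound[where B = 1])
     (use a_measurable a_nonneg a_le_1 in auto)

lemma c0_nonneg: "0 \<le> c 0"
  unfolding integral_a[symmetric] by (intro integral_nonneg_AE AE_I2) (simp add: a_nonneg)

text \<open>Events become functions with values in \<open>[0, 1]\<close> on the torus:
  \<open>heads j\<close> stands in for the indicator that coin \<open>j\<close> shows heads, and
  products stand in for intersections.\<close>

definition heads :: "nat \<Rightarrow> (nat \<Rightarrow> complex) \<Rightarrow> real" where
  "heads j \<zeta> = a (\<zeta> (Suc (n + j)))"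

definition tails :: "nat set \<Rightarrow> (nat \<Rightarrow> complex) \<Rightarrow> real" where
  "tails S \<zeta> = (\<Prod>i\<in>S. 1 - heads i \<zeta>)"

definition one_head :: "(nat \<Rightarrow> complex) \<Rightarrow> real" where
  "one_head \<zeta> = (\<Sum>j<n. heads j \<zeta> * tails ({..<n} - {j}) \<zeta>)"

text \<open>A factor \<open>1 - heads i\<close> has frequencies between \<open>-D\<close> and
  \<open>D\<close>; the power \<open>D\<close> makes them nonnegative without changing the
  modulus.\<close>

definition shift :: "nat set \<Rightarrow> (nat \<Rightarrow> complex) \<Rightarrow> complex" where
  "shift S \<zeta> = (\<Prod>i\<in>S. \<zeta> (Suc (n + i)) ^ D)"

text \<open>The coordinate \<open>Suc (n + l)\<close> enters only through \<open>\<phi>\<close>,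
  since the other two factors leave it out. The full projection therefore acts on the piece with
  \<open>\<phi> = a\<close> by turning \<open>a\<close> into \<open>a_plus\<close>.\<close>

definition piece :: "(complex \<Rightarrow> complex) \<Rightarrow> nat \<Rightarrow> (nat \<Rightarrow> complex) \<Rightarrow> complex" where
  "piece \<phi> l \<zeta> = shift ({..<n} - {l}) \<zeta> * of_real (tails ({..<n} - {l}) \<zeta>) * \<phi> (\<zeta> (Suc (n + l)))"

definition rest :: "(nat \<Rightarrow> complex) \<Rightarrow> complex" where
  "rest \<zeta> = shift {..<n} \<zeta> * of_real (1 - one_head \<zeta>)"

definition example :: "(complex \<Rightarrow> complex) \<Rightarrow> (nat \<Rightarrow> complex) \<Rightarrow> complex" where
  "example \<phi> \<zeta> = (\<Sum>l<n. \<zeta> l * piece \<phi> l \<zeta>)"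

definition source :: "(nat \<Rightarrow> complex) \<Rightarrow> complex" where
  "source \<zeta> = \<zeta> n * rest \<zeta> + example (\<lambda>z. of_real (a z)) \<zeta>"

definition target :: "(nat \<Rightarrow> complex) \<Rightarrow> complex" where
  "target \<zeta> = \<zeta> n * rest \<zeta> + example a_plus \<zeta>"

lemma coord_in: "i \<le> 2 * n \<Longrightarrow> i \<in> I"
  using I by auto

lemma norm_coord: "\<zeta> \<in> space (torus I) \<Longrightarrow> i \<le> 2 * n \<Longrightarrow> norm (\<zeta> i) = 1"
  by (rule space_torusD[OF _ coord_in])

lemma heads_bounds:
  assumes "\<zeta> \<in> space (torus I)" "j < n"
  shows "0 \<le> heads j \<zeta>" "heads j \<zeta> \<le> 1"
  using norm_coord[OF assms(1), of "Suc (n + j)"] assms(2) a_nonneg a_le_1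
  by (auto simp: heads_def)

lemma tails_bounds:
  assumes "\<zeta> \<in> space (torus I)" "S \<subseteq> {..<n}"
  shows "0 \<le> tails S \<zeta>" "tails S \<zeta> \<le> 1"
  using heads_bounds[OF assms(1)] assms(2) unfolding tails_def
  by (auto intro!: prod_nonneg prod_le_1 simp: subset_iff)

lemma one_head_bounds:
  assumes "\<zeta> \<in> space (torus I)"
  shows "0 \<le> one_head \<zeta>" "one_head \<zeta> \<le> 1"
proof -
  show "0 \<le> one_head \<zeta>"
    unfolding one_head_def
    by (intro sum_nonneg mult_nonneg_nonneg heads_bounds tails_bounds assms) auto
  have "(\<Prod>i<n. 1 - heads i \<zeta>) + one_head \<zeta> \<le> 1"
    unfolding one_head_def tails_def
    by (intro sum_mult_prod_le_1 heads_bounds assms) auto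
  moreover have "0 \<le> (\<Prod>i<n. 1 - heads i \<zeta>)"
    using tails_bounds[OF assms, of "{..<n}"] by (simp add: tails_def)
  ultimately show "one_head \<zeta> \<le> 1" by simp
qed

lemma norm_shift:
  assumes "\<zeta> \<in> space (torus I)" "S \<subseteq> {..<n}"
  shows "norm (shift S \<zeta>) = 1"
  unfolding shift_def prod_norm[symmetric]
  by (intro prod.neutral) (use norm_coord[OF assms(1)] assms(2) in \<open>auto simp: norm_power\<close>)

lemma norm_piece:
  assumes "\<zeta> \<in> space (torus I)" "l < n"
  shows "norm (piece \<phi> l \<zeta>) = tails ({..<n} - {l}) \<zeta> * norm (\<phi> (\<zeta> (Suc (n + l))))"
  using norm_shift[OF assms(1), of "{..<n} - {l}"] tails_bounds[OF assms(1), of "{..<n} - {l}"]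
  by (simp add: piece_def norm_mult)

lemma norm_rest:
  assumes "\<zeta> \<in> space (torus I)"
  shows "norm (rest \<zeta>) = 1 - one_head \<zeta>"
  using norm_shift[OF assms, of "{..<n}"] one_head_bounds[OF assms]
  by (simp add: rest_def norm_mult del: of_real_diff)

text \<open>The moduli of the pieces add up to \<open>one_head\<close> and the remaining term has
  modulus \<open>1 - one_head\<close>. These weights take the place of the disjointness of the
  events.\<close>

lemma norm_source_le:
  assumes "\<zeta> \<in> space (torus I)"
  shows "norm (source \<zeta>) \<le> 1"
proof -
  have "norm (example (\<lambda>z. of_real (a z)) \<zeta>) \<le>
      (\<Sum>l<n. norm (\<zeta> l * piece (\<lambda>z. of_real (a z)) l \<zeta>))"
    unfolding example_def by (rule norm_sum)
  also have "\<dots> = one_head \<zeta>"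
    unfolding one_head_def
  proof (rule sum.cong[OF refl])
    fix l assume "l \<in> {..<n}"
    then show "norm (\<zeta> l * piece (\<lambda>z. of_real (a z)) l \<zeta>) = heads l \<zeta> * tails ({..<n} - {l}) \<zeta>"
      using norm_coord[OF assms, of l] norm_piece[OF assms, of l "\<lambda>z. of_real (a z)"]
        heads_bounds[OF assms, of l]
      by (simp add: norm_mult heads_def)
  qed
  finally have "norm (source \<zeta>) \<le> norm (\<zeta> n * rest \<zeta>) + one_head \<zeta>"
    unfolding source_def by (rule norm_triangle_mono[OF order_refl])
  then show ?thesis
    using norm_coord[OF assms, of n] norm_rest[OF assms] by (simp add: norm_mult)
qed

lemma coord_measurable: "i \<le> 2 * n \<Longrightarrow> (\<lambda>\<zeta>. \<zeta> i) \<in> borel_measurable (torus I)"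
  using measurable_torus_coord[OF coord_in measurable_circle_borel[OF continuous_on_id]] .

lemma heads_measurable: "j < n \<Longrightarrow> heads j \<in> borel_measurable (torus I)"
  using measurable_torus_coord[OF coord_in a_measurable, of "Suc (n + j)"]
  by (simp add: heads_def[abs_def])

lemma tails_measurable: "S \<subseteq> {..<n} \<Longrightarrow> tails S \<in> borel_measurable (torus I)"
  unfolding tails_def[abs_def]
  by (intro borel_measurable_prod borel_measurable_diff borel_measurable_const heads_measurable) auto

lemma one_head_measurable: "one_head \<in> borel_measurable (torus I)"
  unfolding one_head_def[abs_def]
  by (intro borel_measurable_sum borel_measurable_times tails_measurable heads_measurable) auto

lemma shift_measurable: "S \<subseteq> {..<n} \<Longrightarrow> shift S \<in> borel_measurable (torus I)"
  unfolding shift_def[abs_def]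
  by (intro borel_measurable_prod borel_measurable_power coord_measurable) auto

lemma rest_measurable: "rest \<in> borel_measurable (torus I)"
  unfolding rest_def[abs_def]
  using shift_measurable[of "{..<n}"] one_head_measurable by measurable

lemma piece_measurable:
  assumes "\<phi> \<in> borel_measurable circle_measure" "l < n"
  shows "piece \<phi> l \<in> borel_measurable (torus I)"
  unfolding piece_def[abs_def]
  using shift_measurable[of "{..<n} - {l}"] tails_measurable[of "{..<n} - {l}"]
    measurable_torus_coord[OF coord_in assms(1), of "Suc (n + l)"] assms(2)
  by simp

lemma example_measurable:
  assumes "\<phi> \<in> borel_measurable circle_measure"
  shows "example \<phi> \<in> borel_measurable (torus I)"
  unfolding example_def[abs_def]
  by (intro borel_measurable_sum borel_measurable_times coord_measurable piece_measurable assms) auto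

lemma a_plus_measurable: "a_plus \<in> borel_measurable circle_measure"
  unfolding a_plus_def[abs_def] by (intro measurable_circle_borel continuous_intros)

lemma source_measurable: "source \<in> borel_measurable (torus I)"
  unfolding source_def[abs_def]
  by (intro borel_measurable_add borel_measurable_times coord_measurable rest_measurable
      example_measurable) (use a_measurable in auto)

lemma target_measurable: "target \<in> borel_measurable (torus I)"
  unfolding target_def[abs_def]
  by (intro borel_measurable_add borel_measurable_times coord_measurable rest_measurable
      example_measurable a_plus_measurable) auto

text \<open>Multiplication by \<open>z^D\<close> turns \<open>z^j + z^(-j)\<close> into
  \<open>z^(D + j) + z^(D - j)\<close>, and \<open>j \<le> D\<close> keeps both exponents
  nonnegative.\<close>

lemma trig_poly_shifted_a:
  assumes A: "index_monoid I A" and k: "k \<in> I" "\<And>m. (\<lambda>i. if i = k then int m else 0) \<in> A"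
  shows "trig_poly I A (\<lambda>\<zeta>. \<zeta> k ^ D * of_real (a (\<zeta> k)))"
proof -
  have "of_real (a z) * z ^ D = (\<Sum>j\<le>D. of_real (c j / 2) * (z ^ (D + j) + z ^ (D - j)))"
    if z: "norm z = 1" for z
  proof -
    have "of_real (c j * Re (z ^ j)) * z ^ D = of_real (c j / 2) * (z ^ (D + j) + z ^ (D - j))"
      if "j \<le> D" for j
    proof -
      have "z ^ j * cnj (z ^ j) = 1"
        using z by (simp only: complex_norm_square[symmetric] norm_power) simp
      moreover have "z ^ D = z ^ (D - j) * z ^ j" using that by (simp flip: power_add)
      ultimately have "cnj (z ^ j) * z ^ D = z ^ (D - j)" by (simp add: mult_ac)
      then have "(z ^ j + cnj (z ^ j)) * z ^ D = z ^ (D + j) + z ^ (D - j)"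
        by (simp only: distrib_right distrib_left power_add mult.commute)
      moreover have "of_real (c j * Re (z ^ j)) = of_real (c j / 2) * (z ^ j + cnj (z ^ j))"
        unfolding complex_add_cnj by simp
      ultimately show ?thesis by (simp only: mult.assoc)
    qed
    then show ?thesis unfolding a_eq[OF z] of_real_sum sum_distrib_right by (intro sum.cong) auto
  qed
  then have "\<zeta> k ^ D * of_real (a (\<zeta> k)) =
      (\<Sum>j\<le>D. of_real (c j / 2) * (\<zeta> k ^ (D + j) + \<zeta> k ^ (D - j)))" if "\<zeta> \<in> space (torus I)" for \<zeta>
    using space_torusD[OF that k(1)] by (simp add: mult.commute)
  moreover have "trig_poly I A (\<lambda>\<zeta>. \<Sum>j\<le>D. of_real (c j / 2) * (\<zeta> k ^ (D + j) + \<zeta> k ^ (D - j)))"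
    by (intro trig_poly_sum trig_poly_times[OF A] trig_poly_const[OF A] trig_poly_add trig_poly_coord k)
  ultimately show ?thesis by (subst trig_poly_cong) auto
qed

lemma trig_poly_shift_tails:
  assumes A: "index_monoid I A" and S: "S \<subseteq> {..<n}"
    and k: "\<And>i m. i \<in> S \<Longrightarrow> (\<lambda>k. if k = Suc (n + i) then int m else 0) \<in> A"
  shows "trig_poly I A (\<lambda>\<zeta>. shift S \<zeta> * of_real (tails S \<zeta>))"
proof -
  have "shift S \<zeta> * of_real (tails S \<zeta>) =
      (\<Prod>i\<in>S. \<zeta> (Suc (n + i)) ^ D + - (\<zeta> (Suc (n + i)) ^ D * of_real (a (\<zeta> (Suc (n + i))))))" for \<zeta>
    by (simp add: shift_def tails_def heads_def algebra_simps flip: prod.distrib)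
  moreover have "trig_poly I A (\<lambda>\<zeta>. \<Prod>i\<in>S. \<zeta> (Suc (n + i)) ^ D +
      - (\<zeta> (Suc (n + i)) ^ D * of_real (a (\<zeta> (Suc (n + i))))))"
    using S
    by (intro trig_poly_prod[OF A] trig_poly_add trig_poly_minus[OF A] trig_poly_coord trig_poly_shifted_a[OF A]
        k coord_in) auto
  ultimately show ?thesis by simp
qed

lemma trig_poly_rest: "trig_poly I (nonneg_multi_indices I) rest"
proof -
  let ?A = "nonneg_multi_indices I"
  note A = index_monoid_nonneg[of I]
  have single: "(\<lambda>k. if k = Suc (n + i) then int m else 0) \<in> ?A" if "i < n" for i m
    using that by (intro single_nonneg coord_in) auto
  \<comment> \<open>The power belonging to coin \<open>j\<close> is detached, to be paired with
    \<open>a\<close> at this coin, while the remaining powers are paired with \<open>tails\<close>.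
    Each product then has nonnegative frequencies only.\<close>
  have split: "shift {..<n} \<zeta> = \<zeta> (Suc (n + j)) ^ D * shift ({..<n} - {j}) \<zeta>" if "j < n" for j \<zeta>
    unfolding shift_def using that by (subst prod.remove[of _ j]) auto
  have "rest = (\<lambda>\<zeta>. shift {..<n} \<zeta> + - (\<Sum>j<n. (\<zeta> (Suc (n + j)) ^ D * of_real (a (\<zeta> (Suc (n + j))))) *
      (shift ({..<n} - {j}) \<zeta> * of_real (tails ({..<n} - {j}) \<zeta>))))"
    unfolding rest_def[abs_def] one_head_def heads_def
    by (auto simp: fun_eq_iff algebra_simps sum_distrib_left sum_distrib_right split intro!: sum.cong)
  moreover have "trig_poly I ?A (\<lambda>\<zeta>. shift {..<n} \<zeta> + - (\<Sum>j<n. (\<zeta> (Suc (n + j)) ^ D * of_real (a (\<zeta> (Suc (n + j))))) *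
      (shift ({..<n} - {j}) \<zeta> * of_real (tails ({..<n} - {j}) \<zeta>))))"
    unfolding shift_def[of "{..<n}"]
    by (intro trig_poly_add trig_poly_minus[OF A] trig_poly_sum trig_poly_times[OF A] trig_poly_prod[OF A]
        trig_poly_coord trig_poly_shifted_a[OF A] trig_poly_shift_tails[OF A] single coord_in) auto
  ultimately show ?thesis by simp
qed

lemma trig_poly_target: "trig_poly I (nonneg_multi_indices I) target"
proof -
  let ?A = "nonneg_multi_indices I"
  note A = index_monoid_nonneg[of I]
  have single: "(\<lambda>k. if k = i then int m else 0) \<in> ?A" if "i \<le> 2 * n" for i m
    using that by (intro single_nonneg coord_in) auto
  have coord: "trig_poly I ?A (\<lambda>\<zeta>. \<zeta> i)" if "i \<le> 2 * n" for i
    using trig_poly_coord[OF single[OF that, of 1]] by simp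
  show ?thesis
    unfolding target_def[abs_def] example_def piece_def a_plus_def
    by (intro trig_poly_add trig_poly_sum trig_poly_times[OF A] trig_poly_const[OF A] trig_poly_rest
        coord trig_poly_shift_tails[OF A] trig_poly_coord single) auto
qed

text \<open>In the \<open>l\<close>-th summand \<open>a_minus\<close> gives the coordinate
  \<open>Suc (n + l)\<close> a negative frequency, and no other factor contains this coordinate to
  compensate for it.\<close>

lemma trig_poly_example_a_minus:
  "trig_poly I (multi_indices I - nonneg_multi_indices I) (example a_minus)"
  unfolding example_def[abs_def]
proof (rule trig_poly_sum)
  fix l assume "l \<in> {..<n}"
  then have l: "l < n" by simp
  let ?k = "Suc (n + l)"
  let ?A = "{\<alpha> \<in> nonneg_multi_indices I. \<alpha> ?k = 0}" and ?B = "{\<alpha> \<in> multi_indices I. \<alpha> ?k < 0}"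
  note A = index_monoid_nonneg_zero[of I ?k]
  have single: "(\<lambda>k. if k = i then int m else 0) \<in> ?A" if "i \<le> 2 * n" "i \<noteq> ?k" for i m
    using single_nonneg[OF coord_in[OF that(1)], of m] that(2) by auto
  have "trig_poly I ?A (\<lambda>\<zeta>. \<zeta> l)"
    using trig_poly_coord[OF single[of l 1]] l by simp
  then have f: "trig_poly I ?A (\<lambda>\<zeta>. \<zeta> l * (shift ({..<n} - {l}) \<zeta> * of_real (tails ({..<n} - {l}) \<zeta>)))"
    by (intro trig_poly_times[OF A] trig_poly_shift_tails[OF A] single) auto
  have "(\<lambda>k. if k = ?k then - int m else 0) \<in> ?B" if "m \<ge> 1" for m
    using l coord_in[of ?k] that by (auto simp: multi_indices_def)
  then have g: "trig_poly I ?B (\<lambda>\<zeta>. a_minus (\<zeta> ?k))"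
    unfolding a_minus_def character_single[symmetric]
    by (intro trig_poly_sum trig_poly_character) auto
  have "trig_poly I (multi_indices I - nonneg_multi_indices I)
      (\<lambda>\<zeta>. \<zeta> l * (shift ({..<n} - {l}) \<zeta> * of_real (tails ({..<n} - {l}) \<zeta>)) * a_minus (\<zeta> ?k))"
  proof (rule trig_poly_mult[OF f g])
    fix \<alpha> \<beta> assume \<alpha>: "\<alpha> \<in> ?A" and \<beta>: "\<beta> \<in> ?B"
    then have "(\<lambda>i. \<alpha> i + \<beta> i) \<in> multi_indices I"
      using multi_indices_combine[of \<alpha> I \<beta> "(+)"] by (auto simp: nonneg_multi_indices_def)
    moreover have "\<alpha> ?k + \<beta> ?k < 0" using \<alpha> \<beta> by auto
    then have "(\<lambda>i. \<alpha> i + \<beta> i) \<notin> nonneg_multi_indices I"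
      unfolding nonneg_multi_indices_def by (auto intro!: exI[of _ ?k])
    ultimately show "(\<lambda>i. \<alpha> i + \<beta> i) \<in> multi_indices I - nonneg_multi_indices I" by simp
  qed (auto simp: nonneg_multi_indices_def)
  then show "trig_poly I (multi_indices I - nonneg_multi_indices I) (\<lambda>\<zeta>. \<zeta> l * piece a_minus l \<zeta>)"
    by (simp add: piece_def mult.assoc)
qed

lemma has_riesz_projection_source: "has_riesz_projection I source target"
proof (rule has_riesz_projection_trig_poly[OF trig_poly_target target_measurable trig_poly_example_a_minus])
  fix \<zeta> assume \<zeta>: "\<zeta> \<in> space (torus I)"
  have "piece (\<lambda>z. of_real (a z)) l \<zeta> = piece a_plus l \<zeta> + piece a_minus l \<zeta>" if "l < n" for l
    using a_eq_plus_minus[of "\<zeta> (Suc (n + l))"] norm_coord[OF \<zeta>, of "Suc (n + l)"] that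
    by (simp add: piece_def distrib_left)
  then show "source \<zeta> = target \<zeta> + example a_minus \<zeta>"
    by (simp add: source_def target_def example_def distrib_left sum.distrib)
qed

end

subsection \<open>Lower bound for the norm\<close>

context kakeya_example
begin

lemma integral_prod_heads:
  assumes meas: "\<And>i. i < n \<Longrightarrow> \<phi> i \<in> borel_measurable circle_measure"
    and bdd: "\<And>i z. i < n \<Longrightarrow> norm z = 1 \<Longrightarrow> \<bar>\<phi> i z :: real\<bar> \<le> 1"
  shows "(LINT \<zeta>|torus I. (\<Prod>i<n. \<phi> i (\<zeta> (Suc (n + i))))) = (\<Prod>i<n. LINT z|circle_measure. \<phi> i z)"
proof -
  let ?h = "\<lambda>i. Suc (n + i)" and ?\<phi> = "\<lambda>k. \<phi> (k - Suc n)"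
  have inj: "inj_on ?h {..<n}" by (auto simp: inj_on_def)
  have "(LINT \<zeta>|torus I. (\<Prod>k\<in>?h ` {..<n}. ?\<phi> k (\<zeta> k))) = (\<Prod>k\<in>?h ` {..<n}. LINT z|circle_measure. ?\<phi> k z)"
    using coord_in meas bdd by (intro torus_integral_prod) auto
  then show ?thesis by (simp add: prod.reindex[OF inj])
qed

lemma integral_one_head: "(LINT \<zeta>|torus I. one_head \<zeta>) = n * (c 0 * (1 - c 0) ^ (n - 1))"
proof -
  have eq: "heads j \<zeta> * tails ({..<n} - {j}) \<zeta> =
      (\<Prod>i<n. (if i = j then a else (\<lambda>z. 1 - a z)) (\<zeta> (Suc (n + i))))" if "j < n" for j \<zeta>
    using that unfolding tails_def heads_def by (subst prod.remove[of _ j]) (auto intro!: prod.cong)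
  have term_j: "(LINT \<zeta>|torus I. heads j \<zeta> * tails ({..<n} - {j}) \<zeta>) = c 0 * (1 - c 0) ^ (n - 1)"
    if "j < n" for j
  proof -
    have "(LINT \<zeta>|torus I. heads j \<zeta> * tails ({..<n} - {j}) \<zeta>) =
        (\<Prod>i<n. LINT z|circle_measure. (if i = j then a else (\<lambda>z. 1 - a z)) z)"
      unfolding eq[OF that]
      by (rule integral_prod_heads) (use a_measurable a_nonneg a_le_1 in auto)
    also have "\<dots> = (\<Prod>i<n. if i = j then c 0 else 1 - c 0)"
      using a_integrable by (intro prod.cong) (auto simp: integral_a circle.prob_space[simplified])
    also have "\<dots> = c 0 * (\<Prod>i\<in>{..<n} - {j}. if i = j then c 0 else 1 - c 0)"
      using that by (subst prod.remove[of _ j]) auto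
    also have "(\<Prod>i\<in>{..<n} - {j}. if i = j then c 0 else 1 - c 0) = (\<Prod>i\<in>{..<n} - {j}. 1 - c 0)"
      by (rule prod.cong) auto
    finally show ?thesis using that by simp
  qed
  have int: "integrable (torus I) (\<lambda>\<zeta>. heads j \<zeta> * tails ({..<n} - {j}) \<zeta>)" if "j < n" for j
  proof (rule integrable_bounded_torus[where B = 1])
    show "(\<lambda>\<zeta>. heads j \<zeta> * tails ({..<n} - {j}) \<zeta>) \<in> borel_measurable (torus I)"
      using that by (intro borel_measurable_times heads_measurable tails_measurable) auto
    fix \<zeta> assume "\<zeta> \<in> space (torus I)"
    then show "norm (heads j \<zeta> * tails ({..<n} - {j}) \<zeta>) \<le> 1"
      using heads_bounds[of \<zeta> j] tails_bounds[of \<zeta> "{..<n} - {j}"] that by (auto simp: mult_le_one)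
  qed
  have "(LINT \<zeta>|torus I. one_head \<zeta>) = (\<Sum>j<n. LINT \<zeta>|torus I. heads j \<zeta> * tails ({..<n} - {j}) \<zeta>)"
    unfolding one_head_def using int by (subst Bochner_Integration.integral_sum) auto
  then show ?thesis by (simp add: term_j)
qed

lemma integral_tails_powr:
  assumes "r \<ge> 0"
  shows "(LINT \<zeta>|torus I. tails {..<n} \<zeta> powr r) = (LINT z|circle_measure. (1 - a z) powr r) ^ n"
proof -
  have "(LINT \<zeta>|torus I. tails {..<n} \<zeta> powr r) =
      (LINT \<zeta>|torus I. (\<Prod>i<n. (1 - a (\<zeta> (Suc (n + i)))) powr r))"
    by (simp add: tails_def heads_def prod_powr_distrib)
  also have "\<dots> = (\<Prod>i<n. LINT z|circle_measure. (1 - a z) powr r)"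
    by (rule integral_prod_heads) (use a_measurable a_nonneg a_le_1 assms in \<open>auto intro!: powr_le1\<close>)
  finally show ?thesis by simp
qed

text \<open>Averaging over the signs bounds the moment from below by a square function.
  Superadditivity separates \<open>rest\<close>, which contributes 1 minus the loss, from the
  pieces, which contribute the gain: each of the \<open>n\<close> pieces has size at least
  \<open>c 0 / 2\<close> times \<open>tails {..<n}\<close>.\<close>

lemma target_lower_bound:
  assumes r: "r > 1"
  shows "1 - 2 * r * (n * (c 0 * (1 - c 0) ^ (n - 1))) +
      n powr r * (c 0 / 2) powr (2 * r) * (LINT z|circle_measure. (1 - a z) powr (2 * r)) ^ n
    \<le> (LINT \<zeta>|torus I. norm (target \<zeta>) powr (2 * r))"
proof -
  \<comment> \<open>\<open>u l\<close> is the coefficient of the sign \<open>\<zeta> l\<close> in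
    \<open>target\<close>, with \<open>rest\<close> at the index \<open>n\<close>.\<close>
  define u where "u l = (if l = n then rest else piece a_plus l)" for l
  define C where "C = 1 + \<bar>c 0\<bar> + (\<Sum>k=1..D. \<bar>c k / 2\<bar>)"
  have C: "C \<ge> 1" "\<And>z. norm z = 1 \<Longrightarrow> norm (a_plus z) \<le> C"
    using norm_a_plus_le by (force simp: C_def intro: sum_nonneg add_nonneg_nonneg)+
  let ?X = "\<lambda>\<zeta>. \<Sum>l<Suc n. (norm (u l \<zeta>))\<^sup>2"
  let ?T = "tails {..<n}"
  have u_meas: "u l \<in> borel_measurable (torus I)" if "l < Suc n" for l
    using that rest_measurable piece_measurable[OF a_plus_measurable, of l] by (auto simp: u_def)
  have u_bdd: "norm (u l \<zeta>) \<le> C" if "l < Suc n" "\<zeta> \<in> space (torus I)" for l \<zeta>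
  proof (cases "l = n")
    case True
    then show ?thesis
      using norm_rest[OF that(2)] one_head_bounds[OF that(2)] C(1) by (simp add: u_def)
  next
    case False
    then have l: "l < n" using that by simp
    have "tails ({..<n} - {l}) \<zeta> * norm (a_plus (\<zeta> (Suc (n + l)))) \<le> 1 * C"
      using tails_bounds[OF that(2), of "{..<n} - {l}"]
        C(2)[OF norm_coord[OF that(2), of "Suc (n + l)"]] l
      by (intro mult_mono) auto
    then show ?thesis using False norm_piece[OF that(2) l, of a_plus] by (simp add: u_def)
  qed
  have "(LINT \<zeta>|torus I. ?X \<zeta> powr r) \<le> (LINT \<zeta>|torus I. norm (\<Sum>l<Suc n. \<zeta> l * u l \<zeta>) powr (2 * r))"
  proof (rule torus_integral_randomized_sum[where C = C])
    show "{..<Suc n} \<subseteq> I" using coord_in by auto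
    \<comment> \<open>The signs are the coordinates up to \<open>n\<close>, whereas
      \<open>u l\<close> depends only on the coins, which start at \<open>Suc n\<close>.\<close>
    fix l k \<zeta> and x :: complex assume "k \<in> {..<Suc n}"
    then have "(\<zeta>(k := x)) (Suc (n + i)) = \<zeta> (Suc (n + i))" for i by simp
    then show "u l (\<zeta>(k := x)) = u l \<zeta>"
      by (simp only: u_def rest_def piece_def one_head_def tails_def heads_def shift_def split: if_split) simp
  qed (use r u_meas u_bdd in auto)
  also have "(\<lambda>\<zeta>. \<Sum>l<Suc n. \<zeta> l * u l \<zeta>) = target"
    by (simp add: fun_eq_iff u_def target_def example_def)
  finally have upper: "(LINT \<zeta>|torus I. ?X \<zeta> powr r) \<le> (LINT \<zeta>|torus I. norm (target \<zeta>) powr (2 * r))"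
    by (simp only: fun_eq_iff)
  let ?Y = "\<lambda>\<zeta>. 1 - 2 * r * one_head \<zeta> + (n powr r * (c 0 / 2) powr (2 * r)) * ?T \<zeta> powr (2 * r)"
  have pointwise: "?Y \<zeta> \<le> ?X \<zeta> powr r" if \<zeta>: "\<zeta> \<in> space (torus I)" for \<zeta>
  proof -
    note T = tails_bounds[OF \<zeta>, of "{..<n}", simplified]
    have sq: "(t\<^sup>2) powr r = t powr (2 * r)" if "t \<ge> 0" for t :: real
      using that by (simp add: powr_powr flip: powr_numeral)
    have "1 - 2 * r * one_head \<zeta> \<le> ((norm (rest \<zeta>))\<^sup>2) powr r"
      using powr_ge_linear[of "1 - one_head \<zeta>" "2 * r"] one_head_bounds[OF \<zeta>] r
      by (simp add: norm_rest[OF \<zeta>] sq)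
    moreover have "(n powr r * (c 0 / 2) powr (2 * r)) * ?T \<zeta> powr (2 * r) \<le>
        (\<Sum>l<n. (norm (piece a_plus l \<zeta>))\<^sup>2) powr r"
    proof -
      have "(c 0 / 2 * ?T \<zeta>)\<^sup>2 \<le> (norm (piece a_plus l \<zeta>))\<^sup>2" if "l < n" for l
      proof -
        have 1: "norm (\<zeta> (Suc (n + l))) = 1" using norm_coord[OF \<zeta>, of "Suc (n + l)"] that by simp
        have "c 0 / 2 \<le> Re (a_plus (\<zeta> (Suc (n + l))))"
          using Re_a_plus[OF 1] a_nonneg[OF 1] by simp
        also have "\<dots> \<le> norm (a_plus (\<zeta> (Suc (n + l))))" by (rule complex_Re_le_cmod)
        finally have A: "c 0 / 2 \<le> norm (a_plus (\<zeta> (Suc (n + l))))" .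
        have "?T \<zeta> = (1 - heads l \<zeta>) * tails ({..<n} - {l}) \<zeta>"
          unfolding tails_def using that by (subst prod.remove[of _ l]) auto
        also have "\<dots> \<le> 1 * tails ({..<n} - {l}) \<zeta>"
          using heads_bounds[OF \<zeta> that] tails_bounds[OF \<zeta>, of "{..<n} - {l}"]
          by (intro mult_right_mono) auto
        finally have "c 0 / 2 * ?T \<zeta> \<le> norm (piece a_plus l \<zeta>)"
          using A T c0_nonneg by (simp only: norm_piece[OF \<zeta> that] mult.commute[of "tails _ _"])
            (intro mult_mono; simp)
        then show ?thesis using T c0_nonneg by (intro power_mono) auto
      qed
      then have "(\<Sum>l<n. (c 0 / 2 * ?T \<zeta>)\<^sup>2) \<le> (\<Sum>l<n. (norm (piece a_plus l \<zeta>))\<^sup>2)"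
        by (intro sum_mono) simp
      \<comment> \<open>The \<open>n\<close> equal terms produce the factor \<open>n^r\<close>; for
        \<open>r > 1\<close> it outgrows the factor \<open>n\<close> in the loss.\<close>
      then have "(n * (c 0 / 2 * ?T \<zeta>)\<^sup>2) powr r \<le> (\<Sum>l<n. (norm (piece a_plus l \<zeta>))\<^sup>2) powr r"
        using r by (intro powr_mono2) auto
      moreover have "(n * (k * ?T \<zeta>)\<^sup>2) powr r = (n powr r * k powr (2 * r)) * ?T \<zeta> powr (2 * r)"
        if "k \<ge> 0" for k
        using T that by (simp add: powr_mult sq power_mult_distrib)
      from this[of "c 0 / 2"] have "(n * (c 0 / 2 * ?T \<zeta>)\<^sup>2) powr r =
          (n powr r * (c 0 / 2) powr (2 * r)) * ?T \<zeta> powr (2 * r)"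
        using c0_nonneg by simp
      ultimately show ?thesis by simp
    qed
    ultimately have "?Y \<zeta> \<le> ((norm (rest \<zeta>))\<^sup>2) powr r + (\<Sum>l<n. (norm (piece a_plus l \<zeta>))\<^sup>2) powr r"
      by simp
    also have "\<dots> \<le> ((norm (rest \<zeta>))\<^sup>2 + (\<Sum>l<n. (norm (piece a_plus l \<zeta>))\<^sup>2)) powr r"
      using r by (intro powr_superadditive) (auto intro: sum_nonneg)
    also have "(norm (rest \<zeta>))\<^sup>2 + (\<Sum>l<n. (norm (piece a_plus l \<zeta>))\<^sup>2) = ?X \<zeta>"
      by (simp add: u_def)
    finally show ?thesis .
  qed
  note [measurable] = one_head_measurable tails_measurable[of "{..<n}", simplified]
  have int_q: "integrable (torus I) one_head"
    by (rule integrable_bounded_torus[where B = 1]) (use one_head_bounds in auto)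
  have int_T: "integrable (torus I) (\<lambda>\<zeta>. ?T \<zeta> powr (2 * r))"
    by (rule integrable_bounded_torus[where B = 1])
       (use tails_bounds[of _ "{..<n}"] r in \<open>auto intro!: powr_le1\<close>)
  have X_le: "?X \<zeta> \<le> real (card {..<Suc n}) * C\<^sup>2" if "\<zeta> \<in> space (torus I)" for \<zeta>
    using u_bdd that by (intro sum_bounded_above power_mono) auto
  have int_X: "integrable (torus I) (\<lambda>\<zeta>. ?X \<zeta> powr r)"
  proof (rule integrable_bounded_torus[where B = "(real (card {..<Suc n}) * C\<^sup>2) powr r"])
    show "(\<lambda>\<zeta>. ?X \<zeta> powr r) \<in> borel_measurable (torus I)"
      using u_meas by (intro powr_real_measurable borel_measurable_sum borel_measurable_power
          borel_measurable_norm borel_measurable_const) auto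
    fix \<zeta> assume "\<zeta> \<in> space (torus I)"
    then show "norm (?X \<zeta> powr r) \<le> (real (card {..<Suc n}) * C\<^sup>2) powr r"
      unfolding real_norm_def using X_le r
      by (subst abs_of_nonneg) (auto intro!: powr_mono2 sum_nonneg simp del: sum.lessThan_Suc card_lessThan)
  qed
  have "(LINT \<zeta>|torus I. ?Y \<zeta>) \<le> (LINT \<zeta>|torus I. ?X \<zeta> powr r)"
    using int_q int_T int_X pointwise by (intro integral_mono) (auto simp del: sum.lessThan_Suc)
  moreover have "(LINT \<zeta>|torus I. ?Y \<zeta>) = 1 - 2 * r * (n * (c 0 * (1 - c 0) ^ (n - 1))) +
      n powr r * (c 0 / 2) powr (2 * r) * (LINT z|circle_measure. (1 - a z) powr (2 * r)) ^ n"
    using int_q int_T r by (simp add: integral_one_head integral_tails_powr torus.prob_space)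
  ultimately show ?thesis using upper by linarith
qed

lemma target_bounded: "\<exists>B. \<forall>\<zeta>\<in>space (torus I). norm (target \<zeta>) \<le> B"
proof -
  obtain F c where "finite F" "F \<subseteq> nonneg_multi_indices I"
      "\<forall>\<zeta>\<in>space (torus I). target \<zeta> = trig_sum F c \<zeta>"
    using trig_poly_target unfolding trig_poly_def by blast
  then show ?thesis
    using norm_trig_sum_le[of F I _ c] nonneg_multi_indices_subset[of I] by (metis order_trans)
qed

text \<open>\<open>source\<close> is admissible in \<open>riesz_norm\<close> and its projection is
  \<open>target\<close> almost everywhere, so a moment of \<open>target\<close> above 1 refutes the
  norm bound. The moment is estimated at \<open>2 * r\<close> and carried over to every larger
  \<open>p\<close>.\<close>

lemma riesz_norm_gt_1:
  assumes r: "r > 1" and p: "p \<ge> 2 * r"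
    and ineq: "2 * r * (n * (c 0 * (1 - c 0) ^ (n - 1))) <
      n powr r * (c 0 / 2) powr (2 * r) * (LINT z|circle_measure. (1 - a z) powr (2 * r)) ^ n"
  shows "riesz_norm I p > 1"
proof (rule ccontr)
  assume "\<not> riesz_norm I p > 1"
  then have le: "riesz_norm I p \<le> 1" by simp
  obtain B where B: "\<And>\<zeta>. \<zeta> \<in> space (torus I) \<Longrightarrow> norm (target \<zeta>) \<le> B"
    using target_bounded by blast
  note [measurable] = source_measurable target_measurable
  have int: "integrable (torus I) (\<lambda>\<zeta>. norm (target \<zeta>) powr s)" if "s \<ge> 0" for s
    by (rule integrable_bounded_torus[where B = "B powr s"]) (use B that in \<open>auto intro: powr_mono2\<close>)
  let ?J = "\<lambda>s. LINT \<zeta>|torus I. norm (target \<zeta>) powr s"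
  have Linf: "Linf_norm (torus I) source \<le> 1"
    unfolding Linf_norm_def using norm_source_le by (intro esssup_I) (auto simp: ennreal_le_1)
  have "Lp_norm (torus I) p (riesz_projection I source) \<le> riesz_norm I p"
    unfolding riesz_norm_def using Linf source_measurable by (intro SUP_upper) auto
  also have "\<dots> \<le> ennreal 1" using le by simp
  finally have "(\<integral>\<^sup>+\<zeta>. ennreal (norm (riesz_projection I source \<zeta>) powr p) \<partial>torus I) \<le> ennreal 1"
    using r p by (subst (asm) Lp_norm_le_iff) auto
  also have "(\<integral>\<^sup>+\<zeta>. ennreal (norm (riesz_projection I source \<zeta>) powr p) \<partial>torus I) =
      (\<integral>\<^sup>+\<zeta>. ennreal (norm (target \<zeta>) powr p) \<partial>torus I)"
    using has_riesz_projection_unique[OF has_riesz_projection_riesz_projection[OF source_measurable Linf]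
        has_riesz_projection_source]
    by (intro nn_integral_cong_AE) (auto elim!: eventually_mono)
  also have "\<dots> = ennreal (?J p)"
    using r p by (intro nn_integral_eq_integral int) auto
  finally have J_le: "?J p \<le> 1" by simp
  have J_gt: "?J (2 * r) > 1" using target_lower_bound[OF r] ineq by linarith
  \<comment> \<open>Bernoulli's inequality for the power \<open>s\<close> of
    \<open>|target|^(2 r)\<close> shows that a mean above 1 stays above 1. The case
    \<open>s = 1\<close> is an equality and stands apart because \<open>powr_ge_linear\<close> asks
    for an exponent above 1.\<close>
  define s where "s = p / (2 * r)"
  have s: "s \<ge> 1" "p = 2 * r * s" using p r by (auto simp: s_def field_simps)
  have "1 + s * (norm (target \<zeta>) powr (2 * r) - 1) \<le> norm (target \<zeta>) powr p" for \<zeta>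
  proof (cases "s = 1")
    case False
    then show ?thesis
      using powr_ge_linear[of "norm (target \<zeta>) powr (2 * r)" s] s by (simp add: powr_powr)
  qed (use s in simp)
  then have "(LINT \<zeta>|torus I. 1 + s * (norm (target \<zeta>) powr (2 * r) - 1)) \<le> ?J p"
    using int[of "2 * r"] int[of p] r p by (intro integral_mono) auto
  also have "(LINT \<zeta>|torus I. 1 + s * (norm (target \<zeta>) powr (2 * r) - 1)) = 1 + s * (?J (2 * r) - 1)"
    using int[of "2 * r"] r by (simp add: torus.prob_space)
  finally have "s * (?J (2 * r) - 1) \<le> 0" using J_le by simp
  moreover have "s * (?J (2 * r) - 1) > 0" using s(1) J_gt by simp
  ultimately show False by simp
qed

end

section \<open>Approximation of the indicator of a half circle by cosine polynomials\<close>

text \<open>The zeros of the cosine are countable, so the end points of the half circle form a null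
  set. Convergence of the approximations is established away from it.\<close>

lemma AE_circle_Re_nonzero: "AE z in circle_measure. Re z \<noteq> 0"
proof -
  have "{t. cos (2 * pi * t) = 0} \<subseteq> range (\<lambda>i::int. real_of_int i / 4)"
  proof
    fix t assume "t \<in> {t. cos (2 * pi * t) = 0}"
    then obtain i :: int where "2 * pi * t = of_int i * (pi / 2)"
      by (auto simp: cos_zero_iff_int)
    then have "t = real_of_int i / 4" by (simp add: field_simps)
    then show "t \<in> range (\<lambda>i::int. real_of_int i / 4)" by blast
  qed
  then have "countable {t. cos (2 * pi * t) = 0}"
    by (rule countable_subset) simp
  then have "{t. cos (2 * pi * t) = 0} \<in> null_sets lborel"
    by (rule countable_imp_null_set_lborel)
  then have "AE t in lborel. cos (2 * pi * t) \<noteq> 0"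
    by (rule AE_I') auto
  then have "AE t in uniform_measure lborel {0..1::real}. cos (2 * pi * t) \<noteq> 0"
    by (subst AE_uniform_measure) auto
  moreover have "{z \<in> space (restrict_space borel (sphere 0 1)). Re z \<noteq> 0} \<in>
      sets (restrict_space borel (sphere (0::complex) 1))"
  proof -
    have [measurable]: "Re \<in> borel_measurable (restrict_space borel (sphere 0 1))"
      by (intro borel_measurable_continuous_on_restrict continuous_intros)
    show ?thesis by measurable
  qed
  ultimately show ?thesis
    unfolding circle_measure_def using measurable_cis_circle
    by (subst AE_distr_iff) (auto simp: cis.simps)
qed

text \<open>This is the event of tails: \<open>exists_riesz_norm_gt_1\<close> takes
  \<open>a = 1 - approx_left_half m\<close>, so heads corresponds to the right half.\<close>

definition left_half :: "complex \<Rightarrow> real" where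
  "left_half z = (if Re z < 0 then 1 else 0)"

lemma left_half_bounds: "0 \<le> left_half z" "left_half z \<le> 1"
  by (simp_all add: left_half_def)

text \<open>A polynomial in \<open>x = (1 + Re z) / 2\<close> with values in \<open>[0, 1]\<close>,
  as in an elementary proof of the Stone-Weierstrass theorem. Since
  \<open>2^m x^m = (2 x)^m\<close>, the threshold lies at \<open>x = 1/2\<close>, that is at
  \<open>Re z = 0\<close>.\<close>

definition approx_left_half :: "nat \<Rightarrow> complex \<Rightarrow> real" where
  "approx_left_half m z = (1 - ((1 + Re z) / 2) ^ m) ^ (2 ^ m)"

lemma Re_half_bounds:
  assumes "norm z = 1"
  shows "0 \<le> (1 + Re z) / 2" "(1 + Re z) / 2 \<le> 1"
  using abs_Re_le_cmod[of z] assms by auto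

lemma approx_left_half_bounds:
  assumes "norm z = 1"
  shows "0 \<le> approx_left_half m z" "approx_left_half m z \<le> 1"
  using Re_half_bounds[OF assms]
  by (auto simp: approx_left_half_def intro!: zero_le_power power_le_one)

text \<open>Bernoulli's inequality gives the lower bound \<open>1 - (2 x)^m\<close>, which tends to
  1 on the left half. On the right half \<open>1 - t \<le> exp (-t)\<close> gives the upper bound
  \<open>exp (- (2 x)^m)\<close>, which tends to 0.\<close>

lemma approx_left_half_tendsto:
  assumes z: "norm z = 1" and nz: "Re z \<noteq> 0"
  shows "(\<lambda>m. approx_left_half m z) \<longlonglongrightarrow> left_half z"
proof -
  define x where "x = (1 + Re z) / 2"
  have x: "0 \<le> x" "x \<le> 1" using Re_half_bounds[OF z] by (auto simp: x_def)
  have eq: "approx_left_half m z = (1 - x ^ m) ^ (2 ^ m)" for m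
    by (simp add: approx_left_half_def x_def)
  have pow: "2 ^ m * x ^ m = (2 * x) ^ m" for m by (simp add: power_mult_distrib)
  show ?thesis
  proof (cases "Re z < 0")
    case True
    then have "2 * x < 1" by (simp add: x_def)
    then have "(\<lambda>m. (2 * x) ^ m) \<longlonglongrightarrow> 0" using x by (intro LIMSEQ_realpow_zero) auto
    then have "(\<lambda>m. 1 - (2 * x) ^ m) \<longlonglongrightarrow> 1 - 0" by (rule tendsto_diff[OF tendsto_const])
    then have lim: "(\<lambda>m. 1 - (2 * x) ^ m) \<longlonglongrightarrow> 1" by (simp only: diff_zero)
    have ge: "1 - (2 * x) ^ m \<le> approx_left_half m z" for m
    proof -
      have "1 - (2 * x) ^ m = 1 + real (2 ^ m) * (- (x ^ m))"
        by (simp add: power_mult_distrib)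
      also have "\<dots> \<le> (1 + - (x ^ m)) ^ (2 ^ m)"
        using x by (intro Bernoulli_inequality) (simp add: power_le_one)
      finally show ?thesis by (simp only: eq diff_conv_add_uminus)
    qed
    have "(\<lambda>m. approx_left_half m z) \<longlonglongrightarrow> 1"
      by (rule tendsto_sandwich[OF _ _ lim tendsto_const])
         (intro always_eventually allI ge approx_left_half_bounds(2)[OF z])+
    then show ?thesis using True by (simp add: left_half_def)
  next
    case False
    then have "2 * x > 1" using nz by (simp add: x_def)
    then have lim: "(\<lambda>m. (1 / (2 * x)) ^ m) \<longlonglongrightarrow> 0"
      by (intro LIMSEQ_realpow_zero) auto
    have le: "approx_left_half m z \<le> (1 / (2 * x)) ^ m" for m
    proof -
      have pos: "(2 * x) ^ m > 0" using \<open>2 * x > 1\<close> by (intro zero_less_power) simp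
      have "approx_left_half m z \<le> exp (- (x ^ m)) ^ (2 ^ m)"
        unfolding eq using exp_ge_add_one_self[of "- (x ^ m)"] x
        by (intro power_mono) (auto simp: power_le_one)
      also have "\<dots> = 1 / exp ((2 * x) ^ m)"
        by (simp add: exp_minus inverse_eq_divide power_one_over flip: exp_of_nat_mult pow)
      also have "\<dots> \<le> 1 / (2 * x) ^ m"
      proof (rule divide_left_mono)
        show "(2 * x) ^ m \<le> exp ((2 * x) ^ m)"
          using exp_ge_add_one_self[of "(2 * x) ^ m"] by linarith
        show "0 < exp ((2 * x) ^ m) * (2 * x) ^ m" by (intro mult_pos_pos pos exp_gt_zero)
      qed simp
      finally show ?thesis by (simp add: power_one_over)
    qed
    have "(\<lambda>m. approx_left_half m z) \<longlonglongrightarrow> 0"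
      by (rule tendsto_sandwich[OF _ _ tendsto_const lim])
         (intro always_eventually allI le approx_left_half_bounds(1)[OF z])+
    then show ?thesis using False by (simp add: left_half_def)
  qed
qed

lemma approx_left_half_measurable: "approx_left_half m \<in> borel_measurable circle_measure"
  unfolding approx_left_half_def[abs_def] by (intro measurable_circle_borel continuous_intros) auto

lemma Re_measurable_circle: "Re \<in> borel_measurable circle_measure"
  by (intro measurable_circle_borel continuous_intros)

lemma left_half_measurable: "left_half \<in> borel_measurable circle_measure"
proof -
  note [measurable] = Re_measurable_circle
  show ?thesis unfolding left_half_def[abs_def] by measurable
qed

text \<open>The limit is the same for all \<open>s > 0\<close>, because an indicator equals each of
  its positive powers. Thus \<open>1 - a\<close> and its power \<open>2 * r\<close> have the same
  limiting mean.\<close>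

lemma integral_approx_left_half_powr_tendsto:
  assumes "s > 0"
  shows "(\<lambda>m. LINT z|circle_measure. approx_left_half m z powr s) \<longlonglongrightarrow> (LINT z|circle_measure. left_half z)"
proof (rule integral_dominated_convergence[where w = "\<lambda>_. 1"])
  note [measurable] = approx_left_half_measurable left_half_measurable
  show "left_half \<in> borel_measurable circle_measure"
    "(\<lambda>z. approx_left_half m z powr s) \<in> borel_measurable circle_measure" for m by measurable
  show "AE z in circle_measure. (\<lambda>m. approx_left_half m z powr s) \<longlonglongrightarrow> left_half z"
    using AE_circle_Re_nonzero AE_space[of circle_measure]
  proof eventually_elim
    case (elim z)
    then have "(\<lambda>m. approx_left_half m z powr s) \<longlonglongrightarrow> left_half z powr s"
      using assms approx_left_half_bounds(1)[of z]
      by (intro tendsto_powr' approx_left_half_tendsto tendsto_const) auto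
    then show ?case by (simp add: left_half_def split: if_splits)
  qed
  show "AE z in circle_measure. norm (approx_left_half m z powr s) \<le> 1" for m
    using approx_left_half_bounds assms by (intro AE_I2) (auto intro!: powr_le1)
qed simp

text \<open>\<open>Re z\<close> has mean 0. If one half circle were null, \<open>Re z\<close> would
  have a constant sign almost everywhere and hence vanish almost everywhere, against
  \<open>AE_circle_Re_nonzero\<close>.\<close>

lemma integral_left_half_bounds:
  "0 < (LINT z|circle_measure. left_half z)" "(LINT z|circle_measure. left_half z) < 1"
proof -
  note [measurable] = left_half_measurable Re_measurable_circle
  have int: "integrable circle_measure left_half"
    by (rule circle.integrable_const_bound[where B = 1]) (auto simp: left_half_def)
  have int_Re: "integrable circle_measure Re"
    by (rule circle.integrable_const_bound[where B = 1])
       (use abs_Re_le_cmod in \<open>auto intro!: AE_I2, metis\<close>)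
  have int_id: "integrable circle_measure (\<lambda>z::complex. z)"
    by (rule circle.integrable_const_bound[where B = 1])
       (auto intro!: measurable_circle_borel continuous_intros)
  have zero: "(LINT z|circle_measure. Re z) = 0"
    using circle_integral_powi[of 1] int_id by (simp add: integral_Re)
  have one_sign: False if "AE z in circle_measure. 0 \<le> e * Re z" "e \<noteq> 0" for e :: real
  proof -
    have "(LINT z|circle_measure. e * Re z) = 0" using zero by simp
    then have "AE z in circle_measure. e * Re z = 0"
      using integral_nonneg_eq_0_iff_AE[OF _ that(1)] int_Re by simp
    then have "AE z in circle_measure. False"
      using AE_circle_Re_nonzero by eventually_elim (use that(2) in simp)
    then show False by simp
  qed
  show "0 < (LINT z|circle_measure. left_half z)"
  proof (rule ccontr)
    assume "\<not> ?thesis"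
    moreover have "0 \<le> (LINT z|circle_measure. left_half z)"
      by (intro integral_nonneg_AE AE_I2) (simp add: left_half_bounds)
    ultimately have "(LINT z|circle_measure. left_half z) = 0" by linarith
    then have "AE z in circle_measure. left_half z = 0"
      using integral_nonneg_eq_0_iff_AE[OF int] by (simp add: left_half_bounds)
    then have "AE z in circle_measure. 0 \<le> 1 * Re z"
      by eventually_elim (simp add: left_half_def split: if_splits)
    then show False by (rule one_sign) simp
  qed
  show "(LINT z|circle_measure. left_half z) < 1"
  proof (rule ccontr)
    assume "\<not> ?thesis"
    moreover have *: "(LINT z|circle_measure. 1 - left_half z) = 1 - (LINT z|circle_measure. left_half z)"
      using int by (simp add: circle.prob_space[simplified])
    moreover have "0 \<le> (LINT z|circle_measure. 1 - left_half z)"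
      by (intro integral_nonneg_AE AE_I2) (simp add: left_half_bounds)
    ultimately have "(LINT z|circle_measure. 1 - left_half z) = 0" by linarith
    moreover have "integrable circle_measure (\<lambda>z. 1 - left_half z)" using int by simp
    ultimately have "AE z in circle_measure. 1 - left_half z = 0"
      by (subst (asm) integral_nonneg_eq_0_iff_AE) (auto simp: left_half_bounds)
    then have "AE z in circle_measure. 0 \<le> (-1) * Re z"
      by eventually_elim (simp add: left_half_def split: if_splits)
    then show False by (rule one_sign) simp
  qed
qed

lemma cos_poly_approx_left_half: "cos_poly (\<lambda>z. 1 - approx_left_half m z)"
  unfolding approx_left_half_def add_divide_distrib
  by (intro cos_poly_diff cos_poly_power cos_poly_add cos_poly_const cos_poly_mult)
     (use cos_poly_mult[OF cos_poly_Re cos_poly_const[of "1/2"]] in simp)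

text \<open>First \<open>n\<close> is fixed so that the gain beats the loss for the exact indicator,
  then \<open>m\<close> so that this persists for the polynomial. Neither choice involves
  \<open>I\<close> or \<open>p'\<close>.\<close>

lemma exists_riesz_norm_gt_1:
  assumes "p > 2"
  shows "\<exists>n. \<forall>I p'. {..2 * n} \<subseteq> I \<longrightarrow> p \<le> p' \<longrightarrow> 1 < riesz_norm I p'"
proof -
  define r where "r = p / 2"
  have r: "r > 1" "p = 2 * r" using assms by (auto simp: r_def)
  define \<beta> where "\<beta> = (LINT z|circle_measure. left_half z)"
  have \<beta>: "0 < \<beta>" "\<beta> < 1" unfolding \<beta>_def by (rule integral_left_half_bounds)+
  \<comment> \<open>For the exact indicator tails has probability \<open>\<beta>\<close>, and gain
    minus loss is \<open>n \<beta>^(n - 1) (n^(r - 1) \<kappa> - 2 r (1 - \<beta>))\<close>.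
    Accordingly \<open>M\<close> is the threshold that \<open>n^(r - 1)\<close> has to pass.\<close>
  define \<kappa> where "\<kappa> = ((1 - \<beta>) / 2) powr (2 * r) * \<beta>"
  have \<kappa>: "\<kappa> > 0" using \<beta> by (simp add: \<kappa>_def)
  define M where "M = 2 * r * (1 - \<beta>) / \<kappa>"
  have M: "M > 0" using \<kappa> \<beta> r by (simp add: M_def)
  obtain n where n: "real n > M powr (1 / (r - 1))" using reals_Archimedean2 by blast
  then have n0: "n > 0" using powr_ge_zero[of M "1 / (r - 1)"] by (cases n) auto
  have "M = (M powr (1 / (r - 1))) powr (r - 1)" using M r by (simp add: powr_powr)
  also have "\<dots> < n powr (r - 1)" using n r by (intro powr_less_mono2) auto
  finally have large: "2 * r * (1 - \<beta>) < n powr (r - 1) * \<kappa>"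
    using \<kappa> by (simp add: M_def field_simps)
  let ?a = "\<lambda>m z. 1 - approx_left_half m z"
  let ?c = "\<lambda>m. LINT z|circle_measure. ?a m z"
  let ?e = "\<lambda>m. LINT z|circle_measure. approx_left_half m z powr (2 * r)"
  \<comment> \<open>Gain minus loss as a function of the mean \<open>\<gamma>\<close> of
    \<open>a\<close> and the mean \<open>\<epsilon>\<close> of \<open>(1 - a)^(2 r)\<close>;
    positivity is the hypothesis \<open>ineq\<close> of \<open>riesz_norm_gt_1\<close>. With
    \<open>n\<close> fixed, continuity transfers positivity from the limit to some
    \<open>m\<close>.\<close>
  let ?H = "\<lambda>(\<gamma>::real) (\<epsilon>::real). n powr r * (\<gamma> / 2) powr (2 * r) * \<epsilon> ^ n - 2 * r * (n * (\<gamma> * (1 - \<gamma>) ^ (n - 1)))"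
  have int: "integrable circle_measure (approx_left_half m)" for m
    by (rule circle.integrable_const_bound[where B = 1])
       (use approx_left_half_bounds approx_left_half_measurable in auto)
  have "(\<lambda>m. LINT z|circle_measure. approx_left_half m z) \<longlonglongrightarrow> \<beta>"
  proof -
    have "(LINT z|circle_measure. approx_left_half m z powr 1) = (LINT z|circle_measure. approx_left_half m z)" for m
      by (rule Bochner_Integration.integral_cong) (auto simp: approx_left_half_bounds)
    then show ?thesis using integral_approx_left_half_powr_tendsto[of 1] by (simp add: \<beta>_def)
  qed
  then have c_lim: "?c \<longlonglongrightarrow> 1 - \<beta>"
    using int by (auto simp: circle.prob_space[simplified] intro!: tendsto_intros)
  have e_lim: "?e \<longlonglongrightarrow> \<beta>"
    unfolding \<beta>_def using r by (intro integral_approx_left_half_powr_tendsto) simp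
  have "(\<lambda>m. ?H (?c m) (?e m)) \<longlonglongrightarrow> ?H (1 - \<beta>) \<beta>"
    using \<beta> by (intro tendsto_intros tendsto_powr c_lim e_lim) auto
  moreover have "?H (1 - \<beta>) \<beta> > 0"
  proof -
    obtain k where k: "n = Suc k" using n0 by (cases n) auto
    have "real n powr r = n * n powr (r - 1)" using n0 by (simp add: powr_diff)
    then have "?H (1 - \<beta>) \<beta> = n * \<beta> ^ k * (n powr (r - 1) * \<kappa> - 2 * r * (1 - \<beta>))"
      by (simp add: \<kappa>_def k algebra_simps)
    then show ?thesis using large n0 \<beta> by simp
  qed
  ultimately have "\<forall>\<^sub>F m in sequentially. ?H (?c m) (?e m) > 0"
    by (rule order_tendstoD)
  then obtain m where m: "?H (?c m) (?e m) > 0"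
    by (auto simp: eventually_sequentially)
  obtain D c where c: "\<And>z. norm z = 1 \<Longrightarrow> ?a m z = (\<Sum>k\<le>D. c k * Re (z ^ k))"
    using cos_polyE[OF cos_poly_approx_left_half[of m]] by blast
  show ?thesis
  proof (intro exI[of _ n] allI impI)
    fix I :: "nat set" and p' assume I: "{..2 * n} \<subseteq> I" and p': "p \<le> p'"
    interpret kakeya_example I n D c "?a m"
      by unfold_locales (rule I, erule c, use approx_left_half_bounds[of _ m] in auto)
    \<comment> \<open>\<open>integral_a\<close> identifies the mean \<open>?c m\<close> with the
      coefficient \<open>c 0\<close> in \<open>riesz_norm_gt_1\<close>.\<close>
    show "1 < riesz_norm I p'"
      by (rule riesz_norm_gt_1[OF r(1)]) (use p' r m integral_a in auto)
  qed
qed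

section \<open>The critical exponents\<close>

text \<open>The supremum could run through arbitrarily large exponents, so all
  \<open>p' \<ge> p\<close> are excluded at once. Uniformity in \<open>I\<close> covers the tori of
  large finite dimension and the infinite one together.\<close>

lemma critical_exponent_le:
  assumes "p > 2"
  shows "\<exists>n. \<forall>I. {..n} \<subseteq> I \<longrightarrow> critical_exponent I \<le> ereal p"
proof -
  obtain n where n: "\<And>I p'. {..2 * n} \<subseteq> I \<Longrightarrow> p \<le> p' \<Longrightarrow> 1 < riesz_norm I p'"
    using exists_riesz_norm_gt_1[OF assms] by blast
  have "critical_exponent I \<le> ereal p" if "{..2 * n} \<subseteq> I" for I
    unfolding critical_exponent_def
  proof (rule Sup_least, clarify)
    fix p' assume "riesz_norm I p' \<le> 1"
    then show "ereal p' \<le> ereal p" using n[OF that, of p'] by fastforce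
  qed
  then show ?thesis by blast
qed

lemma p_inf_eq_2: "p_inf = 2"
proof (rule antisym)
  show "p_inf \<le> 2"
  proof (rule ereal_le_epsilon2)
    fix e :: real assume "0 < e"
    then show "p_inf \<le> 2 + ereal e"
      using critical_exponent_le[of "2 + e"] by (auto simp: p_inf_def)
  qed
  show "2 \<le> p_inf" unfolding p_inf_def by (rule critical_exponent_ge_2)
qed

theorem theorem2p1:
  shows "p_fin \<longlonglongrightarrow> p_inf \<and> p_inf = 2"
proof
  have "p_fin \<longlonglongrightarrow> 2"
  proof (rule order_tendstoI)
    fix y :: ereal assume "y < 2"
    then show "\<forall>\<^sub>F n in sequentially. y < p_fin n"
      unfolding p_fin_def
      by (intro always_eventually allI) (rule less_le_trans[OF _ critical_exponent_ge_2])
  next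
    fix y :: ereal assume "2 < y"
    then obtain q where q: "2 < ereal q" "ereal q < y" using ereal_dense2 by blast
    then obtain N where N: "\<And>I. {..N} \<subseteq> I \<Longrightarrow> critical_exponent I \<le> ereal q"
      using critical_exponent_le[of q] by auto
    \<comment> \<open>\<open>{..N}\<close> lies in \<open>{..<n}\<close> exactly when
      \<open>N < n\<close>, hence the strict inequality.\<close>
    have "p_fin n < y" if "N < n" for n
      unfolding p_fin_def using that by (intro le_less_trans[OF N q(2)]) auto
    then show "\<forall>\<^sub>F n in sequentially. p_fin n < y"
      using eventually_gt_at_top[of N] by (rule eventually_mono[rotated])
  qed
  then show "p_fin \<longlonglongrightarrow> p_inf" by (simp add: p_inf_eq_2)
qed (rule p_inf_eq_2)

end
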